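(* Let $F(x,y)\in\mathbb{Z}[x,y]$ be a reduced diagonalizable form of degree $r\geq 6$ with $D<0$. Let $h$ be a positive integer and let $m\geq 2$ be an integer. Let $$Y_L=\frac{r^{i_1}h^{i_2}}{|j|^{i_3}},$$ where $$i_1=2+\frac{2}{r},\qquad i_2=\frac{1}{r-2}+\frac{r-3}{(r-2)(r-1)^{m-1}},\qquad i_3=\begin{cases}0 & \text{if } |j|\geq 1,\\ \frac{r}{2(r-2)} & \text{otherwise.}\end{cases}$$ Then $$N_F(h;Y_L)\leq mr.$$
   Context: A binary form $F(x,y)\in\mathbb{Z}[x,y]$ of degree $r$ is called diagonalizable if it can be written as $F(x,y)=(\alpha x+\beta y)^r-(\gamma x+\delta y)^r$ with (complex) constants $\alpha,\beta,\gamma,\delta$ satisfying $j=\alpha\delta-\beta\gamma\neq 0$. For such a form one can write $(\alpha x+\beta y)(\gamma x+\delta y)=\chi(Ax^2+Bxy+Cy^2)$ with $A,B,C\in\mathbb{Z}$ and a constant $\chi$; put $D=D(F)=B^2-4AC$ (which is nonzero). If $D<0$, $F$ is called reduced if the quadratic form $Ax^2+Bxy+Cy^2$ is reduced, i.e. $C\geq A\geq |B|$. A solution $(x,y)\in\mathbb{Z}^2$ is primitive if $\gcd(x,y)=1$. For $Y_L>0$, $N_F(h;Y_L)$ is the number of primitive solutions $(x,y)\in\mathbb{Z}^2$ of $0<|F(x,y)|\leq h$ with $y\geq Y_L$, where $(x,y)$ and $(-x,-y)$ are regarded as one solution. *)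

theory Defs
  imports Complex_Main
begin

text \<open>
  A binary form of degree \<open>r\<close> over the integers is given by its coefficients \<open>F 0, \<dots>, F r\<close>, with
  \<open>F i\<close> the coefficient of \<open>x ^ (r - i) * y ^ i\<close>; values \<open>F i\<close> for \<open>i > r\<close> are ignored.
  The evaluation is polymorphic, so that the same form can be evaluated at integers and at complex
  numbers.
\<close>

definition form_eval :: "nat \<Rightarrow> (nat \<Rightarrow> int) \<Rightarrow> 'a::comm_ring_1 \<Rightarrow> 'a \<Rightarrow> 'a" where
  "form_eval r F x y = (\<Sum>i\<le>r. of_int (F i) * x ^ (r - i) * y ^ i)"

text \<open>
  Identities between polynomials in \<open>x, y\<close> are stated as identities of functions on the complex
  plane, which is the same thing over an infinite field.
\<close>

definition diagonalization ::
    "nat \<Rightarrow> (nat \<Rightarrow> int) \<Rightarrow> complex \<Rightarrow> complex \<Rightarrow> complex \<Rightarrow> complex \<Rightarrow> bool" where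
  "diagonalization r F \<alpha> \<beta> \<gamma> \<delta> \<longleftrightarrow>
     \<alpha> * \<delta> - \<beta> * \<gamma> \<noteq> 0 \<and>
     (\<forall>x y. form_eval r F x y = (\<alpha> * x + \<beta> * y) ^ r - (\<gamma> * x + \<delta> * y) ^ r)"

text \<open>
  \<open>A, B, C\<close> are determined by the linear forms only up to a common nonzero factor; the sign of the
  discriminant does not depend on that factor.
\<close>

definition associated_quadratic ::
    "complex \<Rightarrow> complex \<Rightarrow> complex \<Rightarrow> complex \<Rightarrow> int \<Rightarrow> int \<Rightarrow> int \<Rightarrow> bool" where
  "associated_quadratic \<alpha> \<beta> \<gamma> \<delta> A B C \<longleftrightarrow>
     (\<exists>\<chi>. \<forall>x y. (\<alpha> * x + \<beta> * y) * (\<gamma> * x + \<delta> * y) =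
        \<chi> * (of_int A * x\<^sup>2 + of_int B * x * y + of_int C * y\<^sup>2))"

definition reduced_quadratic :: "int \<Rightarrow> int \<Rightarrow> int \<Rightarrow> bool" where
  "reduced_quadratic A B C \<longleftrightarrow> C \<ge> A \<and> A \<ge> \<bar>B\<bar>"

definition primitive_solutions :: "nat \<Rightarrow> (nat \<Rightarrow> int) \<Rightarrow> nat \<Rightarrow> real \<Rightarrow> (int \<times> int) set" where
  "primitive_solutions r F h Y =
     {(x, y). gcd x y = 1 \<and> 0 < \<bar>form_eval r F x y\<bar> \<and> \<bar>form_eval r F x y\<bar> \<le> int h \<and>
              real_of_int y \<ge> Y}"

definition solution_classes :: "nat \<Rightarrow> (nat \<Rightarrow> int) \<Rightarrow> nat \<Rightarrow> real \<Rightarrow> (int \<times> int) set set" where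
  "solution_classes r F h Y = (\<lambda>(x, y). {(x, y), (- x, - y)}) ` primitive_solutions r F h Y"

text \<open>
  \<open>card\<close> is \<open>0\<close> on infinite sets, so bounds on \<open>num_solutions\<close> have to be accompanied by
  finiteness of \<open>solution_classes\<close>.
\<close>

definition num_solutions :: "nat \<Rightarrow> (nat \<Rightarrow> int) \<Rightarrow> nat \<Rightarrow> real \<Rightarrow> nat" where
  "num_solutions r F h Y = card (solution_classes r F h Y)"

end

theory Submission
  imports Defs "HOL-Analysis.Analysis"
begin

text \<open>
  Let \<open>u = \<alpha> x + \<beta> y\<close> and \<open>v = \<gamma> x + \<delta> y\<close>, so that \<open>F = u ^ r - v ^ r\<close>. As \<open>D < 0\<close>, we have \<open>|u| = |v|\<close> at
  primitive integral points (\<open>norm_v\<close>), and \<open>|u|\<^sup>2\<close> is at least a constant times \<open>|j| y\<^sup>2\<close> because the quadratic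
  form is reduced (\<open>norm_u_ge\<close>). A small value of \<open>F\<close> forces the point \<open>v / u\<close> of the unit circle to be close to one
  of the \<open>r\<close>-th roots of unity. It suffices to show that at most \<open>m\<close> solutions belong to each of them, and after
  multiplication of \<open>v\<close> by a root of unity this root is \<open>1\<close>.

  Order the solutions that belong to the root \<open>1\<close> by the size \<open>T\<close> of \<open>|u|\<close>. Since \<open>u\<^sub>0 v\<^sub>1 - u\<^sub>1 v\<^sub>0\<close> is \<open>j\<close> times a nonzero
  integer, the next solution after one of size \<open>T\<close> has size at least \<open>T ^ (r - 1) / h\<close>, up to a constant
  (\<open>gap_principle\<close>). Starting from the bound \<open>Y_L\<close> and iterating, the solution number \<open>m\<close> has size at least a
  constant times \<open>h\<close> (\<open>aligned_growth\<close>); the exponent of \<open>h\<close> in \<open>Y_L\<close> is made for this. It remains to see that there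
  are no two solutions of such a size (\<open>no_two_large_solutions\<close>).

  This is the method of Thue and Siegel. The diagonal Pade approximants to the \<open>r\<close>-th root are binary forms \<open>P\<^sub>n\<close>
  of degree \<open>n\<close> such that \<open>X P\<^sub>n(X ^ r, Y ^ r) - Y P\<^sub>n(Y ^ r, X ^ r)\<close> vanishes to the order \<open>2 n + 1\<close> at \<open>X = Y\<close>
  (\<open>pade_remainder_le\<close>). With \<open>X = u\<^sub>0\<close> and \<open>Y = v\<^sub>0\<close> from the smaller solution they yield good approximations to
  \<open>1\<close>, and a second large solution would yield another one; the number
  \<open>P\<^sub>n(u\<^sub>0 ^ r, v\<^sub>0 ^ r) u\<^sub>0 v\<^sub>1 - P\<^sub>n(v\<^sub>0 ^ r, u\<^sub>0 ^ r) v\<^sub>0 u\<^sub>1\<close> that compares them is very small for a suitable \<open>n\<close>. On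
  the other hand \<open>r sqrt D u\<^sub>0 ^ r\<close> lies in the quadratic order of discriminant \<open>D\<close> (\<open>resolvent\<close>), so this number is
  \<open>j\<close> times an integer, up to the denominator \<open>r ^ (3 n) |D| ^ (n / 2)\<close> (\<open>pade_cross_lower_bound\<close>). For one of two
  consecutive \<open>n\<close> it is not zero (\<open>pade_cross_nonzero\<close>), which is a contradiction once the denominator is
  under control; for this, \<open>|D|\<close> is bounded in terms of \<open>|j|\<close> (\<open>norm_s_power_le\<close>).
\<close>

section \<open>Binomial coefficients of fractions\<close>

text \<open>
  The power series \<open>(1 + r\<^sup>2 X) ^ (1 / r)\<close> has coefficients in \<open>r \<int>\<close>, apart from the constant one.
  Its \<open>r\<close>-th power is \<open>1 + r\<^sup>2 X\<close>; comparing coefficients there, the new coefficient enters with the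
  factor \<open>r\<close>, while all other contributions are products of at least two earlier nonconstant coefficients and lie
  in \<open>r\<^sup>2 \<int>\<close>.
\<close>

lemma gbinomial_fraction_integral:
  fixes r k :: nat
  assumes "r > 0" "k > 0"
  shows "real r ^ (2*k) * ((1 / real r) gchoose k) / real r \<in> \<int>"
  using \<open>k > 0\<close>
proof (induction k rule: less_induct)
  case (less k)
  define R where "R = real r"
  have R: "R > 0" "R \<in> \<int>" using assms by (auto simp: R_def)
  \<comment> \<open>\<open>c j\<close> is the coefficient sequence of \<open>(1 + r\<^sup>2 X) ^ (j / r)\<close>.\<close>
  define c where "c j i = R ^ (2*i) * ((real j / R) gchoose i)" for j i
  have c_Suc: "c (Suc j) i = (\<Sum>l\<le>i. c j l * c 1 (i - l))" for j i
  proof -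
    have "real (Suc j) / R = real j / R + 1 / R" by (simp add: add_divide_distrib)
    hence "c (Suc j) i = R ^ (2*i) * (\<Sum>l\<le>i. (real j / R gchoose l) * (1 / R gchoose (i - l)))"
      by (simp only: c_def gbinomial_Vandermonde atMost_atLeast0)
    also have "\<dots> = (\<Sum>l\<le>i. c j l * c 1 (i - l))"
      unfolding sum_distrib_left
    proof (rule sum.cong)
      fix l assume "l \<in> {..i}"
      hence e: "2*l + 2*(i-l) = 2*i" by auto
      have "R ^ (2*i) = R ^ (2*l) * R ^ (2*(i-l))" by (simp only: power_add [symmetric] e)
      thus "R ^ (2*i) * ((real j / R gchoose l) * (1 / R gchoose (i - l))) = c j l * c 1 (i - l)"
        by (simp add: c_def)
    qed simp
    finally show ?thesis .
  qed
  have c0: "c j 0 = 1" for j by (simp add: c_def)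
  have IH: "c 1 i / R \<in> \<int>" if "0 < i" "i < k" for i
    using less.IH[of i] that by (simp add: c_def R_def)
  have small: "0 < i \<longrightarrow> i < k \<longrightarrow> c j i / R \<in> \<int>" for j i
  proof (induction j arbitrary: i)
    case 0
    show ?case by (simp add: c_def gbinomial_0_left)
  next
    case (Suc j)
    show ?case
    proof (intro impI)
      assume i: "0 < i" "i < k"
      have "c (Suc j) i / R = (\<Sum>l\<le>i. c j l * c 1 (i - l) / R)"
        by (subst c_Suc) (rule sum_divide_distrib)
      also have "\<dots> \<in> \<int>"
      proof (rule Ints_sum)
        fix l assume l: "l \<in> {..i}"
        show "c j l * c 1 (i - l) / R \<in> \<int>"
        proof (cases "l = 0")
          case True
          thus ?thesis using IH i by (simp add: c0)
        next
          case False
          hence *: "c j l / R \<in> \<int>" using Suc [rule_format, of l] l i by auto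
          have "c 1 (i - l) \<in> \<int>"
          proof (cases "l = i")
            case True thus ?thesis by (simp add: c0)
          next
            case False
            hence "c 1 (i - l) / R \<in> \<int>" using l i by (intro IH) auto
            from Ints_mult[OF this R(2)] show ?thesis using R by simp
          qed
          from Ints_mult[OF * this] show ?thesis by simp
        qed
      qed
      finally show "c (Suc j) i / R \<in> \<int>" .
    qed
  qed
  \<comment> \<open>Modulo \<open>r\<^sup>2\<close>, the coefficient of index \<open>k\<close> is additive in the exponent.\<close>
  have lin: "(c j k - real j * c 1 k) / R^2 \<in> \<int>" for j
  proof (induction j)
    case 0
    show ?case using less.prems by (simp add: c_def gbinomial_0_left)
  next
    case (Suc j)
    have split: "{..k} = insert 0 (insert k {0<..<k})" using less.prems by auto
    have "c (Suc j) k = c 1 k + c j k + (\<Sum>l\<in>{0<..<k}. c j l * c 1 (k - l))"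
      using less.prems by (subst c_Suc) (simp add: split c0)
    hence "(c (Suc j) k - real (Suc j) * c 1 k) / R^2 =
      (c j k - real j * c 1 k) / R^2 + (\<Sum>l\<in>{0<..<k}. (c j l / R) * (c 1 (k - l) / R))"
      by (simp add: algebra_simps add_divide_distrib diff_divide_distrib sum_divide_distrib power2_eq_square)
    also have "\<dots> \<in> \<int>"
      by (intro Ints_add Suc Ints_sum Ints_mult) (use small in auto)
    finally show ?case .
  qed
  have "c r k = (if k = 1 then R^2 else 0)"
  proof -
    have "c r k = R^(2*k) * (1 gchoose k)" using R by (simp add: c_def R_def)
    also have "(1::real) gchoose k = of_nat (1 choose k)"
      by (metis binomial_gbinomial of_nat_1)
    finally show ?thesis using less.prems by (auto simp: binomial_eq_0)
  qed
  hence "c r k / R^2 \<in> \<int>" using R by (auto)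
  from Ints_diff[OF this lin[of r]] have "R * c 1 k / R^2 \<in> \<int>"
    by (simp add: R_def diff_divide_distrib)
  thus ?case using R by (simp add: power2_eq_square c_def R_def)
qed

lemma gbinomial_rational_integral:
  fixes r a k :: nat
  assumes "r > 0"
  shows "real r ^ (2*k) * ((real a / real r) gchoose k) \<in> \<int>"
proof (induction a arbitrary: k)
  case 0
  show ?case by (simp add: gbinomial_0_left)
next
  case (Suc a)
  have "real (Suc a) / real r = real a / real r + 1 / real r" by (simp add: add_divide_distrib)
  hence "real r ^ (2*k) * ((real (Suc a) / real r) gchoose k) =
      real r ^ (2*k) * (\<Sum>l\<le>k. (real a / real r gchoose l) * (1 / real r gchoose (k - l)))"
    by (simp only: gbinomial_Vandermonde atMost_atLeast0)
  also have "\<dots> = (\<Sum>l\<le>k. (real r ^ (2*l) * (real a / real r gchoose l)) *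
      (real r ^ (2*(k-l)) * (1 / real r gchoose (k - l))))"
    unfolding sum_distrib_left
  proof (rule sum.cong)
    fix l assume "l \<in> {..k}"
    hence e: "2*l + 2*(k-l) = 2*k" by auto
    have "real r ^ (2*k) = real r ^ (2*l) * real r ^ (2*(k-l))" by (simp only: power_add [symmetric] e)
    thus "real r ^ (2*k) * ((real a / real r gchoose l) * (1 / real r gchoose (k - l))) =
        (real r ^ (2*l) * (real a / real r gchoose l)) * (real r ^ (2*(k-l)) * (1 / real r gchoose (k - l)))"
      by simp
  qed simp
  also have "\<dots> \<in> \<int>"
  proof (rule Ints_sum, rule Ints_mult [OF Suc])
    fix l
    show "real r ^ (2*(k-l)) * (1 / real r gchoose (k - l)) \<in> \<int>"
    proof (cases "k - l = 0")
      case False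
      hence "real r ^ (2*(k-l)) * (1 / real r gchoose (k - l)) / real r \<in> \<int>"
        using gbinomial_fraction_integral[of r "k-l"] assms by simp
      from Ints_mult[OF this Ints_of_nat[of r]] show ?thesis using assms by simp
    qed simp
  qed
  finally show ?case .
qed

text \<open>
  This is the partial fraction expansion of \<open>n! / (a (a + 1) \<dots> (a + n))\<close>. It turns the double sums
  that come from integrating term by term into products.
\<close>

lemma sum_alternating_binomial_over_shift:
  fixes a :: "'a::field_char_0"
  assumes "\<And>i. i \<le> n \<Longrightarrow> a + of_nat i \<noteq> 0"
  shows "(\<Sum>i\<le>n. (-1)^i * of_nat (n choose i) / (a + of_nat i)) = fact n / pochhammer a (Suc n)"
  using assms
proof (induction n arbitrary: a)
  case 0
  show ?case by simp
next
  case (Suc n)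
  have IH1: "(\<Sum>i\<le>n. (-1)^i * of_nat (n choose i) / (a + of_nat i)) = fact n / pochhammer a (Suc n)"
    using Suc by simp
  have IH2: "(\<Sum>i\<le>n. (-1)^i * of_nat (n choose i) / (a + 1 + of_nat i)) = fact n / pochhammer (a+1) (Suc n)"
  proof (rule Suc.IH)
    fix i assume "i \<le> n" thus "a + 1 + of_nat i \<noteq> 0" using Suc.prems[of "Suc i"] by (simp add: algebra_simps)
  qed
  have nz: "a \<noteq> 0" "a + of_nat (Suc n) \<noteq> 0" using Suc.prems[of 0] Suc.prems[of "Suc n"] by simp_all
  have nz2: "pochhammer (a+1) n \<noteq> 0"
  proof
    assume "pochhammer (a+1) n = 0"
    then obtain k where "k < n" "a + 1 = - of_nat k" by (auto simp: pochhammer_eq_0_iff)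
    moreover have "a + of_nat (Suc k) = (a + 1) + of_nat k" by (simp add: algebra_simps)
    ultimately have "a + of_nat (Suc k) = 0" by simp
    thus False using Suc.prems[of "Suc k"] \<open>k < n\<close> by simp
  qed
  have "(\<Sum>i\<le>Suc n. (-1)^i * of_nat (Suc n choose i) / (a + of_nat i)) =
    (\<Sum>i\<le>Suc n. (-1)^i * of_nat (n choose i) / (a + of_nat i)) +
    (\<Sum>i\<le>n. (-1)^Suc i * of_nat (n choose i) / (a + of_nat (Suc i)))"
    unfolding sum.atMost_Suc_shift[of _ n]
    by (simp add: algebra_simps add_divide_distrib sum.distrib sum_subtractf diff_divide_distrib sum_negf)
  also have "(\<Sum>i\<le>n. (-1)^Suc i * of_nat (n choose i) / (a + of_nat (Suc i))) =
    - (\<Sum>i\<le>n. (-1)^i * of_nat (n choose i) / (a + 1 + of_nat i))"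
    by (simp add: sum_negf algebra_simps)
  also have "(\<Sum>i\<le>Suc n. (-1)^i * of_nat (n choose i) / (a + of_nat i)) =
     (\<Sum>i\<le>n. (-1)^i * of_nat (n choose i) / (a + of_nat i))" by simp
  finally have "(\<Sum>i\<le>Suc n. (-1)^i * of_nat (Suc n choose i) / (a + of_nat i)) =
     fact n / pochhammer a (Suc n) - fact n / pochhammer (a+1) (Suc n)"
    by (simp only: IH1 IH2) simp
  also have "\<dots> = fact n / (a * pochhammer (a+1) n) - fact n / (pochhammer (a+1) n * (a + of_nat (Suc n)))"
    unfolding pochhammer_rec[of a n] pochhammer_Suc[of "a+1" n] by (simp add: algebra_simps)
  also have "\<dots> = fact (Suc n) / (a * (pochhammer (a+1) n * (a + of_nat (Suc n))))"
    using nz nz2 by (simp add: divide_simps) (simp add: algebra_simps)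
  also have "a * (pochhammer (a+1) n * (a + of_nat (Suc n))) = pochhammer a (Suc (Suc n))"
    unfolding pochhammer_rec[of a "Suc n"] pochhammer_Suc[of "a+1" n] by (simp add: algebra_simps)
  finally show ?case .
qed

section \<open>Chords of the unit circle\<close>

lemma abs_le_norm_cis_minus_one:
  assumes "\<bar>x\<bar> \<le> pi"
  shows "\<bar>x\<bar> \<le> 2 * cmod (1 - cis x)"
proof -
  \<comment> \<open>Concavity on \<open>{0..pi}\<close> puts the sine above the chord from \<open>0\<close> to \<open>pi / 2\<close>.\<close>
  have *: "y \<le> 4 * sin (y/2)" if "0 \<le> y" "y \<le> pi" for y
  proof -
    have "sin (y/2) \<ge> (1 - y/pi) *\<^sub>R sin 0 + (y/pi) *\<^sub>R sin (pi/2)"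
    proof -
      have "concave_on {0..pi} sin"
        unfolding concave_on_def
      proof (rule f''_ge0_imp_convex[where f' = "\<lambda>x. - cos x" and f'' = "\<lambda>x. sin x"])
      qed (auto intro!: derivative_eq_intros sin_ge_zero)
      from concave_onD[OF this, of "y/pi" 0 "pi/2"] that show ?thesis by simp
    qed
    hence "sin (y/2) \<ge> y / pi" by simp
    moreover have "y / pi \<ge> y / 4" using that pi_less_4 by (intro divide_left_mono) auto
    ultimately have "y / 4 \<le> sin (y/2)" by linarith
    thus ?thesis by simp
  qed
  have "cmod (1 - cis x) = 2 * \<bar>sin (x / 2)\<bar>"
    using dist_exp_i_1[of x] by (simp add: cis_conv_exp norm_minus_commute)
  moreover have "\<bar>sin (x/2)\<bar> \<ge> \<bar>x\<bar> / 4"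
    using *[of "\<bar>x\<bar>"] assms by (cases "x \<ge> 0") auto
  ultimately show ?thesis by simp
qed

lemma norm_cis_minus_one_le: "cmod (1 - cis x) \<le> \<bar>x\<bar>"
proof -
  have "cmod (1 - cis x) = 2 * \<bar>sin (x / 2)\<bar>"
    using dist_exp_i_1[of x] by (simp add: cis_conv_exp norm_minus_commute)
  also have "\<dots> \<le> 2 * \<bar>x/2\<bar>" using abs_sin_x_le_abs_x[of "x/2"] by simp
  finally show ?thesis by simp
qed

section \<open>Pade approximants to the r-th root\<close>

text \<open>
  For \<open>\<nu> = 1 / r\<close> these are the coefficients of the diagonal Pade approximants at \<open>1\<close> to the \<open>r\<close>-th root:
  numerator and denominator are the same binary form of degree \<open>n\<close> with the two arguments exchanged. The
  product form below shows at once that the coefficients are positive, that their sum is a central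
  binomial coefficient, and that \<open>r ^ (2 * n)\<close> is a common denominator.
\<close>

definition pade_coeff :: "real \<Rightarrow> nat \<Rightarrow> nat \<Rightarrow> real" where
  "pade_coeff \<nu> n l = ((real n - \<nu>) gchoose l) * ((real n + \<nu>) gchoose (n - l))"

definition pade :: "real \<Rightarrow> nat \<Rightarrow> complex \<Rightarrow> complex \<Rightarrow> complex" where
  "pade \<nu> n X Y = (\<Sum>l\<le>n. of_real (pade_coeff \<nu> n l) * X ^ l * Y ^ (n - l))"

lemma gbinomial_pos_real:
  assumes "a > real k - 1"
  shows "(a gchoose k) > 0"
  unfolding gbinomial_prod_rev using assms by (auto intro!: divide_pos_pos prod_pos)

lemma pade_coeff_pos:
  assumes "0 < \<nu>" "\<nu> < 1" "l \<le> n"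
  shows "pade_coeff \<nu> n l > 0"
  unfolding pade_coeff_def using assms by (intro mult_pos_pos gbinomial_pos_real) auto

lemma sum_pade_coeff: "(\<Sum>l\<le>n. pade_coeff \<nu> n l) = real ((2*n) choose n)"
proof -
  have "(\<Sum>l\<le>n. pade_coeff \<nu> n l) = ((real n - \<nu>) + (real n + \<nu>)) gchoose n"
    unfolding pade_coeff_def by (simp only: gbinomial_Vandermonde atMost_atLeast0)
  also have "(real n - \<nu>) + (real n + \<nu>) = real (2*n)" by simp
  finally show ?thesis by (simp only: binomial_gbinomial)
qed

lemma norm_pade_le:
  assumes "0 < \<nu>" "\<nu> < 1" "cmod X \<le> \<rho>" "cmod Y \<le> \<rho>"
  shows "cmod (pade \<nu> n X Y) \<le> 4 ^ n * \<rho> ^ n"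
proof -
  have \<rho>: "\<rho> \<ge> 0" using assms(3) norm_ge_zero order_trans by blast
  have "cmod (pade \<nu> n X Y) \<le> (\<Sum>l\<le>n. pade_coeff \<nu> n l * \<rho> ^ n)"
    unfolding pade_def
  proof (rule sum_norm_le)
    fix l assume "l \<in> {..n}"
    hence l: "l \<le> n" by simp
    have "cmod X ^ l * cmod Y ^ (n - l) \<le> \<rho> ^ l * \<rho> ^ (n - l)"
      using assms \<rho> by (intro mult_mono power_mono) auto
    also have "\<dots> = \<rho> ^ n" using l by (simp flip: power_add)
    finally show "norm (of_real (pade_coeff \<nu> n l) * X ^ l * Y ^ (n - l)) \<le> pade_coeff \<nu> n l * \<rho> ^ n"
      using pade_coeff_pos[OF assms(1,2) l]
      by (simp add: norm_mult norm_power mult.assoc)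
  qed
  also have "\<dots> = real ((2*n) choose n) * \<rho> ^ n"
    by (simp add: sum_pade_coeff flip: sum_distrib_right)
  also have "\<dots> \<le> 4 ^ n * \<rho> ^ n"
  proof (rule mult_right_mono)
    have "(2*n) choose n \<le> 2 ^ (2*n)" by (rule binomial_le_pow2)
    also have "\<dots> = 4 ^ n" by (simp add: power_mult)
    finally show "real ((2*n) choose n) \<le> 4 ^ n" by (metis of_nat_le_iff of_nat_numeral of_nat_power)
  qed (use \<rho> in simp)
  finally show ?thesis .
qed

lemma pade_coeff_integral:
  assumes "r > 0" "l \<le> n"
  shows "real r ^ (2*n) * pade_coeff (1 / real r) n l \<in> \<int>"
proof (cases "n = 0")
  case False
  have e: "2*l + 2*(n-l) = 2*n" using assms by auto
  have "real r ^ (2*n) = real r ^ (2*l) * real r ^ (2*(n-l))" by (simp only: power_add [symmetric] e)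
  hence "real r ^ (2*n) * pade_coeff (1 / real r) n l =
    (real r ^ (2*l) * ((real n - 1 / real r) gchoose l)) *
    (real r ^ (2*(n-l)) * ((real n + 1 / real r) gchoose (n-l)))"
    by (simp add: pade_coeff_def)
  moreover have "real n - 1 / real r = real (r*n - 1) / real r"
    using False assms by (simp add: of_nat_diff Suc_le_eq field_simps)
  moreover have "real n + 1 / real r = real (r*n + 1) / real r"
    using assms by (simp add: field_simps)
  ultimately show ?thesis
    using gbinomial_rational_integral[OF assms(1)] by (metis Ints_mult)
qed (use assms in \<open>simp add: pade_coeff_def\<close>)

text \<open>
  Up to sign this is \<open>(\<nu> - n) (\<nu> - n + 1) \<dots> (\<nu> + n) / (n!)\<^sup>2\<close>, the factor by which the approximants
  differ from the integral that represents the remainder.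
\<close>

definition pade_remainder_const :: "real \<Rightarrow> nat \<Rightarrow> real" where
  "pade_remainder_const \<nu> n = (-1) ^ n * pochhammer (\<nu> - real n) (2*n+1) / (fact n)\<^sup>2"

lemma proper_fraction_plus_int_nonzero:
  assumes "0 < \<nu>" "\<nu> < (1::real)"
  shows "\<nu> + of_int k \<noteq> 0"
proof
  assume "\<nu> + of_int k = 0"
  hence "of_int (-k) = \<nu>" by simp
  hence "0 < -k" "-k < 1" using assms by linarith+
  thus False by simp
qed

text \<open>
  The factors pair up to \<open>\<nu> \<Prod>\<^sub>k (1 - \<nu>\<^sup>2 / k\<^sup>2)\<close>, up to sign.
\<close>

lemma abs_pade_remainder_const_le:
  assumes "0 < \<nu>" "\<nu> < 1"
  shows "\<bar>pade_remainder_const \<nu> n\<bar> \<le> \<nu>"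
proof (induction n)
  case 0
  show ?case using assms by (simp add: pade_remainder_const_def)
next
  case (Suc n)
  have "pochhammer (\<nu> - real (Suc n)) (2 * Suc n + 1) =
     (\<nu> - real (Suc n)) * (pochhammer (\<nu> - real n) (2*n+1) * (\<nu> + real (Suc n)))"
  proof -
    have "pochhammer (\<nu> - real (Suc n)) (Suc (Suc (2*n+1))) =
      (\<nu> - real (Suc n)) * pochhammer (\<nu> - real n) (Suc (2*n+1))"
      by (subst pochhammer_rec) simp
    also have "pochhammer (\<nu> - real n) (Suc (2*n+1)) = pochhammer (\<nu> - real n) (2*n+1) * (\<nu> + real (Suc n))"
      by (subst pochhammer_Suc) simp
    finally show ?thesis by simp
  qed
  moreover have alg: "- s * ((\<nu> - N) * (p * (\<nu> + N))) / (N * f)\<^sup>2 = s * p / f\<^sup>2 * ((N\<^sup>2 - \<nu>\<^sup>2) / N\<^sup>2)"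
    if "N \<noteq> 0" "f \<noteq> 0" for s N p f :: real
    using that by (simp add: field_simps power2_eq_square)
  ultimately have eq: "pade_remainder_const \<nu> (Suc n) =
     pade_remainder_const \<nu> n * ((real (Suc n)^2 - \<nu>^2) / real (Suc n)^2)"
    unfolding pade_remainder_const_def using alg[of "real (Suc n)" "fact n" "(-1)^n"] by simp
  have "\<nu>^2 \<le> real (Suc n)^2" using assms by (intro power_mono) auto
  hence "\<bar>(real (Suc n)^2 - \<nu>^2) / real (Suc n)^2\<bar> \<le> 1" by (simp add: divide_simps)
  hence "\<bar>pade_remainder_const \<nu> (Suc n)\<bar> \<le> \<bar>pade_remainder_const \<nu> n\<bar> * 1"
    unfolding eq abs_mult by (intro mult_left_mono) auto
  thus ?case using Suc by simp
qed

lemma pade_coeff_eq_pochhammer: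
  assumes "0 < \<nu>" "\<nu> < 1" "l \<le> n"
  shows "pade_coeff \<nu> n l = pade_remainder_const \<nu> n *
    ((-1) ^ (n-l) * real (n choose l) * (fact n / pochhammer (real l - real n + \<nu>) (Suc n)))"
proof -
  have nz: "pochhammer (real l - real n + \<nu>) (Suc n) \<noteq> 0"
  proof
    assume "pochhammer (real l - real n + \<nu>) (Suc n) = 0"
    then obtain k where "real l - real n + \<nu> = - real k" by (auto simp: pochhammer_eq_0_iff)
    hence "\<nu> + of_int (int l - int n + int k) = 0" by simp
    thus False using proper_fraction_plus_int_nonzero[OF assms(1,2)] by blast
  qed
  have split: "pochhammer (\<nu> - real n) (2*n+1) = pochhammer (\<nu> - real n) l *
      (pochhammer (real l - real n + \<nu>) (Suc n) * pochhammer (\<nu> + real l + 1) (n - l))"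
  proof -
    have "2*n+1 = l + (Suc n + (n - l))" using assms by simp
    hence "pochhammer (\<nu> - real n) (2*n+1) = pochhammer (\<nu> - real n) (l + (Suc n + (n - l)))"
      by (rule arg_cong)
    also have "\<dots> = pochhammer (\<nu> - real n) l * (pochhammer (\<nu> - real n + real l) (Suc n) *
        pochhammer (\<nu> - real n + real l + real (Suc n)) (n - l))"
      by (simp only: pochhammer_product')
    finally show ?thesis by (simp add: algebra_simps)
  qed
  have g1: "(real n - \<nu>) gchoose l = (-1)^l * pochhammer (\<nu> - real n) l / fact l"
    by (simp add: gbinomial_pochhammer)
  have g2: "(real n + \<nu>) gchoose (n - l) = pochhammer (\<nu> + real l + 1) (n - l) / fact (n - l)"
    using assms by (simp add: gbinomial_pochhammer' of_nat_diff algebra_simps)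
  have b: "real (n choose l) = fact n / (fact l * fact (n - l))"
    using assms by (simp add: binomial_fact)
  have sgn: "(-1::real) ^ n * (-1) ^ (n - l) = (-1) ^ l"
  proof -
    have "(-1::real) ^ n = (-1) ^ l * (-1) ^ (n - l)" using assms by (simp flip: power_add)
    thus ?thesis by (simp add: mult.assoc flip: power_mult_distrib)
  qed
  have "pade_remainder_const \<nu> n *
    ((-1) ^ (n-l) * real (n choose l) * (fact n / pochhammer (real l - real n + \<nu>) (Suc n))) =
    ((-1) ^ n * (-1) ^ (n - l)) * (pochhammer (\<nu> - real n) l * pochhammer (\<nu> + real l + 1) (n - l)) /
      (fact l * fact (n - l))"
    unfolding pade_remainder_const_def split b using nz by (simp add: field_simps power2_eq_square)
  also have "\<dots> = pade_coeff \<nu> n l"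
    unfolding sgn pade_coeff_def g1 g2 by simp
  finally show ?thesis ..
qed

text \<open>
  With \<open>w = cis (r \<phi>)\<close>, the remainder is a multiple of the integral of
  \<open>(1 - z) ^ n (z - w) ^ n z ^ (\<nu> - n - 1)\<close> along the arc \<open>z = cis (r t)\<close> from \<open>1\<close> to \<open>w\<close>. Expanding the
  integrand and integrating term by term gives an antiderivative \<open>H\<close> in \<open>t\<close> whose values at the two
  endpoints are the two values of the form. On the arc both factors of the integrand are at most
  \<open>r |\<phi>|\<close>, which yields the order \<open>2 n + 1\<close> of vanishing with an explicit constant. The parametrization
  by the angle makes \<open>z ^ \<nu> = cis t\<close> single valued.
\<close>

lemma pade_remainder_le:
  fixes r n :: nat and \<phi> :: real
  defines "\<nu> \<equiv> 1 / real r"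
  assumes "r \<ge> 2"
  shows "cmod (pade \<nu> n 1 (cis (real r * \<phi>)) - cis \<phi> * pade \<nu> n (cis (real r * \<phi>)) 1)
     \<le> \<nu> * (real r * \<bar>\<phi>\<bar>) ^ (2*n+1)"
proof -
  have \<nu>: "0 < \<nu>" "\<nu> < 1" and r\<nu>: "real r * \<nu> = 1" using assms by (auto simp: \<nu>_def)
  define w where "w = cis (real r * \<phi>)"
  define x where "x i l = real i + real l - real n + \<nu>" for i l
  have x_nz: "x i l \<noteq> 0" for i l
    using proper_fraction_plus_int_nonzero[OF \<nu>, of "int i + int l - int n"] by (simp add: x_def algebra_simps)
  define c :: "nat \<Rightarrow> nat \<Rightarrow> complex" where
    "c i l = (-1)^i * of_nat (n choose i) * (of_nat (n choose l) * (-w)^(n-l))" for i l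
  define H where "H t = (\<Sum>i\<le>n. \<Sum>l\<le>n. c i l / of_real (x i l) * cis (real r * x i l * t))" for t
  define H' where "H' t = \<i> * of_nat r * (\<Sum>i\<le>n. \<Sum>l\<le>n. c i l * cis (real r * x i l * t))" for t
  have deriv: "(H has_vector_derivative H' t) (at t within S)" for t S
  proof -
    have cis': "((\<lambda>t. cis (a * t)) has_vector_derivative (\<i> * of_real a * cis (a * t))) (at t within S)" for a
      unfolding cis_conv_exp
      by (auto intro!: derivative_eq_intros has_vector_derivative_real_field simp: algebra_simps)
    have "(H has_vector_derivative (\<Sum>i\<le>n. \<Sum>l\<le>n. c i l / of_real (x i l) *
        (\<i> * of_real (real r * x i l) * cis (real r * x i l * t)))) (at t within S)"
      unfolding H_def by (intro has_vector_derivative_sum has_vector_derivative_mult_right cis')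
    also have "(\<Sum>i\<le>n. \<Sum>l\<le>n. c i l / of_real (x i l) *
        (\<i> * of_real (real r * x i l) * cis (real r * x i l * t))) = H' t"
      unfolding H'_def sum_distrib_left using x_nz by (intro sum.cong refl) (simp add: field_simps)
    finally show ?thesis .
  qed
  have H'_eq: "H' t = \<i> * of_nat r * (cis t * cis (- real r * real n * t)) *
      ((1 - cis (real r * t)) ^ n * (cis (real r * t) - w) ^ n)" for t
  proof -
    define q where "q = cis (real r * t)"
    have cis_eq: "cis (real r * x i l * t) = (cis t * cis (- real r * real n * t)) * (q ^ i * q ^ l)" for i l
    proof -
      have "real r * x i l * t = t + (- real r * real n * t) + (real i * (real r * t) + real l * (real r * t))"
        using r\<nu> by (simp add: x_def algebra_simps)
      thus ?thesis unfolding q_def by (simp only: Complex.DeMoivre cis_mult)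
    qed
    define E where "E = cis t * cis (- real r * real n * t)"
    have "(\<Sum>i\<le>n. \<Sum>l\<le>n. c i l * cis (real r * x i l * t)) =
       (\<Sum>i\<le>n. \<Sum>l\<le>n. E * ((of_nat (n choose i) * (-q) ^ i * 1 ^ (n-i)) * (of_nat (n choose l) * q ^ l * (-w) ^ (n - l))))"
      unfolding cis_eq c_def E_def by (intro sum.cong refl) (simp add: power_minus[of q])
    also have "\<dots> = E * ((\<Sum>i\<le>n. of_nat (n choose i) * (-q) ^ i * 1 ^ (n-i)) * (\<Sum>l\<le>n. of_nat (n choose l) * q ^ l * (-w) ^ (n - l)))"
      unfolding sum_product by (simp only: sum_distrib_left)
    also have "\<dots> = E * ((1 - q) ^ n * (q - w) ^ n)"
      unfolding binomial_ring[symmetric] by (simp add: algebra_simps)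
    finally show ?thesis by (simp add: H'_def q_def E_def mult.assoc)
  qed
  have H'_le: "norm (H' t) \<le> real r * (real r * \<bar>\<phi>\<bar>) ^ (2*n)" if "t \<in> closed_segment 0 \<phi>" for t
  proof -
    have t: "\<bar>t\<bar> \<le> \<bar>\<phi>\<bar>" "\<bar>\<phi> - t\<bar> \<le> \<bar>\<phi>\<bar>" using that by (auto simp: closed_segment_eq_real_ivl split: if_splits)
    have "cmod (1 - cis (real r * t)) \<le> real r * \<bar>\<phi>\<bar>"
      using norm_cis_minus_one_le[of "real r * t"] t(1) mult_left_mono[OF t(1), of "real r"]
      by (simp add: abs_mult)
    moreover have "cmod (cis (real r * t) - w) \<le> real r * \<bar>\<phi>\<bar>"
    proof -
      have "cis (real r * t) - w = cis (real r * t) * (1 - cis (real r * (\<phi> - t)))"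
        by (simp add: w_def algebra_simps cis_mult)
      hence "cmod (cis (real r * t) - w) \<le> \<bar>real r * (\<phi> - t)\<bar>"
        using norm_cis_minus_one_le[of "real r * (\<phi> - t)"] by (simp add: norm_mult)
      also have "\<dots> \<le> real r * \<bar>\<phi>\<bar>" using mult_left_mono[OF t(2), of "real r"] by (simp add: abs_mult)
      finally show ?thesis .
    qed
    ultimately have "cmod (1 - cis (real r * t)) ^ n * cmod (cis (real r * t) - w) ^ n \<le>
        (real r * \<bar>\<phi>\<bar>) ^ n * (real r * \<bar>\<phi>\<bar>) ^ n"
      by (intro mult_mono power_mono) auto
    also have "\<dots> = (real r * \<bar>\<phi>\<bar>) ^ (2*n)" by (simp add: mult_2 flip: power_add)
    finally show ?thesis unfolding H'_eq by (simp add: norm_mult norm_power mult_left_mono)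
  qed
  have "norm (H 0 - H \<phi>) \<le> (real r * (real r * \<bar>\<phi>\<bar>) ^ (2*n)) * norm (0 - \<phi>)"
  proof (rule differentiable_bound[where S = "closed_segment 0 \<phi>" and f' = "\<lambda>t h. h *\<^sub>R H' t"])
    fix t assume "t \<in> closed_segment 0 \<phi>"
    note * = H'_le[OF this]
    show "onorm (\<lambda>h. h *\<^sub>R H' t) \<le> real r * (real r * \<bar>\<phi>\<bar>) ^ (2*n)"
    proof (rule onorm_bound)
      fix h :: real
      show "norm (h *\<^sub>R H' t) \<le> real r * (real r * \<bar>\<phi>\<bar>) ^ (2*n) * norm h"
        using mult_left_mono[OF *, of "\<bar>h\<bar>"] by (simp add: mult.commute)
    qed simp
    show "(H has_derivative (\<lambda>h. h *\<^sub>R H' t)) (at t within closed_segment 0 \<phi>)"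
      using deriv unfolding has_vector_derivative_def .
  qed auto
  \<comment> \<open>The mean value inequality replaces the estimate of the integral.\<close>
  hence bound: "cmod (H 0 - H \<phi>) \<le> (real r * \<bar>\<phi>\<bar>) ^ (2*n+1)" by (simp add: mult_ac)
  define P :: "nat \<Rightarrow> complex" where
    "P l = (-1) ^ (n-l) * of_nat (n choose l) * of_real (fact n / pochhammer (real l - real n + \<nu>) (Suc n))" for l
  have inner: "(\<Sum>i\<le>n. (-1)^i * of_nat (n choose i) / of_real (x i l)) =
       (of_real (fact n / pochhammer (real l - real n + \<nu>) (Suc n)) :: complex)" for l
  proof -
    have "(\<Sum>i\<le>n. (-1)^i * of_nat (n choose i) / ((real l - real n + \<nu>) + of_nat i)) =
       fact n / pochhammer (real l - real n + \<nu>) (Suc n)"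
      using x_nz[of _ l] by (intro sum_alternating_binomial_over_shift) (auto simp: x_def algebra_simps)
    hence "of_real (\<Sum>i\<le>n. (-1)^i * of_nat (n choose i) / ((real l - real n + \<nu>) + of_nat i)) =
       (of_real (fact n / pochhammer (real l - real n + \<nu>) (Suc n)) :: complex)" by (simp only:)
    thus ?thesis by (simp add: x_def algebra_simps)
  qed
  have H0: "H 0 = (\<Sum>l\<le>n. P l * w ^ (n-l))"
  proof -
    have "H 0 = (\<Sum>l\<le>n. (\<Sum>i\<le>n. (-1)^i * of_nat (n choose i) / of_real (x i l)) *
        (of_nat (n choose l) * (-w)^(n-l)))"
      unfolding H_def by (subst sum.swap) (simp add: c_def sum_distrib_right)
    also have "\<dots> = (\<Sum>l\<le>n. P l * w ^ (n-l))"
      unfolding inner P_def by (intro sum.cong refl) (simp add: power_minus[of w] mult_ac)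
    finally show ?thesis .
  qed
  have H\<phi>: "H \<phi> = cis \<phi> * (\<Sum>l\<le>n. P l * w ^ l)"
  proof -
    have summand: "c i l / of_real (x i l) * cis (real r * x i l * \<phi>) =
       cis \<phi> * ((-1)^(n-i) * of_nat (n choose i) * w ^ i * ((-1) ^ l * of_nat (n choose l) / of_real (x l i)))"
      if "i \<le> n" "l \<le> n" for i l
    proof -
      have "real r * x i l * \<phi> = \<phi> + real i * (real r * \<phi>) + - (real (n - l) * (real r * \<phi>))"
        using r\<nu> that by (simp add: x_def algebra_simps of_nat_diff)
      hence "cis (real r * x i l * \<phi>) = cis \<phi> * w ^ i * cis (- (real (n - l) * (real r * \<phi>)))"
        unfolding w_def Complex.DeMoivre cis_mult by simp
      moreover have "w ^ (n - l) * cis (- (real (n - l) * (real r * \<phi>))) = 1"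
        unfolding w_def Complex.DeMoivre cis_mult by simp
      moreover have "(-1::complex) ^ i * (-1) ^ (n - l) = (-1) ^ (n - i) * (-1) ^ l"
      proof -
        have "even (i + (n - l)) \<longleftrightarrow> even ((n - i) + l)" using that by presburger
        thus ?thesis by (metis (no_types) neg_one_even_power neg_one_odd_power power_add)
      qed
      ultimately have "c i l * cis (real r * x i l * \<phi>) =
         cis \<phi> * ((-1)^(n-i) * of_nat (n choose i) * w ^ i * ((-1) ^ l * of_nat (n choose l)))"
        unfolding c_def power_minus[of w] by (simp add: mult_ac)
      moreover have "x l i = x i l" by (simp add: x_def)
      ultimately show ?thesis by (simp add: field_simps)
    qed
    have "H \<phi> = (\<Sum>i\<le>n. \<Sum>l\<le>n. cis \<phi> * ((-1)^(n-i) * of_nat (n choose i) * w ^ i *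
         ((-1) ^ l * of_nat (n choose l) / of_real (x l i))))"
      unfolding H_def by (intro sum.cong refl summand) auto
    also have "\<dots> = cis \<phi> * (\<Sum>l\<le>n. P l * w ^ l)"
      unfolding P_def inner[symmetric] by (simp add: sum_distrib_left mult_ac)
    finally show ?thesis .
  qed
  define K where "K = pade_remainder_const \<nu> n"
  have coeff: "of_real (pade_coeff \<nu> n l) = of_real K * P l" if "l \<le> n" for l
    using pade_coeff_eq_pochhammer[OF \<nu> that] by (simp add: K_def P_def)
  have "pade \<nu> n 1 w - cis \<phi> * pade \<nu> n w 1 = of_real K * (H 0 - H \<phi>)"
    unfolding H0 H\<phi> pade_def by (simp add: coeff sum_distrib_left algebra_simps)
  also have "cmod \<dots> = \<bar>K\<bar> * cmod (H 0 - H \<phi>)" by (simp add: norm_mult)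
  also have "\<dots> \<le> \<nu> * (real r * \<bar>\<phi>\<bar>) ^ (2*n+1)"
    using abs_pade_remainder_const_le[OF \<nu>] bound \<nu> unfolding K_def by (intro mult_mono) auto
  finally show ?thesis by (simp add: w_def)
qed

text \<open>
  As a polynomial in \<open>w\<close>, the determinant of two consecutive approximants has degree at most \<open>2 n + 1\<close>.
  Both remainders vanish to order \<open>2 n + 1\<close> at \<open>w = 1\<close>, hence so does the determinant, and it is a
  constant multiple of \<open>(w - 1) ^ (2 n + 1)\<close>. The constant is not zero, as the value at \<open>w = 0\<close> shows.
\<close>

lemma pade_det_nonzero:
  fixes r n :: nat and w :: complex
  defines "\<nu> \<equiv> 1 / real r"
  assumes r: "r \<ge> 2" and w: "w \<noteq> 1"
  shows "pade \<nu> n 1 w * pade \<nu> (Suc n) w 1 \<noteq> pade \<nu> (Suc n) 1 w * pade \<nu> n w 1"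
proof -
  have \<nu>: "0 < \<nu>" "\<nu> < 1" and r\<nu>: "real r * \<nu> = 1" using assms by (auto simp: \<nu>_def)
  define p :: "nat \<Rightarrow> complex poly" where "p k = (\<Sum>l\<le>k. monom (of_real (pade_coeff \<nu> k l)) (k - l))" for k
  define q :: "nat \<Rightarrow> complex poly" where "q k = (\<Sum>l\<le>k. monom (of_real (pade_coeff \<nu> k l)) l)" for k
  have poly_p: "poly (p k) z = pade \<nu> k 1 z" and poly_q: "poly (q k) z = pade \<nu> k z 1" for k z
    by (simp_all add: p_def q_def pade_def poly_sum poly_monom)
  have deg: "degree (p k) \<le> k" "degree (q k) \<le> k" for k
    unfolding p_def q_def by (auto intro!: degree_sum_le order_trans[OF degree_monom_le])
  define \<Delta> where "\<Delta> = p n * q (Suc n) - p (Suc n) * q n"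
  have "degree (p n * q (Suc n)) \<le> 2*n+1" "degree (p (Suc n) * q n) \<le> 2*n+1"
    using degree_mult_le[of "p n" "q (Suc n)"] degree_mult_le[of "p (Suc n)" "q n"]
      deg[of n] deg[of "Suc n"] by linarith+
  hence deg\<Delta>: "degree \<Delta> \<le> 2*n+1" unfolding \<Delta>_def by (intro degree_diff_le)
  have "poly \<Delta> 0 \<noteq> 0"
  proof -
    have p0: "poly (p k) 0 = of_real ((real k - \<nu>) gchoose k)" for k
    proof -
      have "poly (p k) 0 = (\<Sum>l\<in>{k}. of_real (pade_coeff \<nu> k l) * 0 ^ (k - l))"
        unfolding poly_p pade_def by (intro sum.mono_neutral_cong_right) auto
      thus ?thesis by (simp add: pade_coeff_def)
    qed
    have q0: "poly (q k) 0 = of_real ((real k + \<nu>) gchoose k)" for k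
    proof -
      have "poly (q k) 0 = (\<Sum>l\<in>{0}. of_real (pade_coeff \<nu> k l) * 0 ^ l)"
        unfolding poly_q pade_def by (intro sum.mono_neutral_cong_right) auto
      thus ?thesis by (simp add: pade_coeff_def)
    qed
    define g1 g2 where "g1 = ((real n - \<nu>) gchoose n)" and "g2 = ((real n + \<nu>) gchoose n)"
    have pos: "g1 > 0" "g2 > 0" unfolding g1_def g2_def using \<nu> by (auto intro!: gbinomial_pos_real)
    have s1: "(real (Suc n) - \<nu>) gchoose (Suc n) = (real (Suc n) - \<nu>) / real (Suc n) * g1"
      using gbinomial_factors[of "real n - \<nu>" n] by (simp add: g1_def algebra_simps)
    have s2: "(real (Suc n) + \<nu>) gchoose (Suc n) = (real (Suc n) + \<nu>) / real (Suc n) * g2"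
      using gbinomial_factors[of "real n + \<nu>" n] by (simp add: g2_def algebra_simps)
    have alg: "g1 * ((N + \<nu>) / N * g2) - (N - \<nu>) / N * g1 * g2 = 2 * \<nu> * g1 * g2 / N" if "N > 0" for N
      using that by (simp add: field_simps)
    have "poly \<Delta> 0 = of_real (g1 * ((real (Suc n) + \<nu>) gchoose (Suc n)) - ((real (Suc n) - \<nu>) gchoose (Suc n)) * g2)"
      by (simp add: \<Delta>_def p0 q0 g1_def g2_def)
    also have "\<dots> = of_real (2 * \<nu> * g1 * g2 / real (Suc n))"
      unfolding s1 s2 using alg[of "real (Suc n)"] by (simp only: of_nat_0_less_iff zero_less_Suc)
    finally have "poly \<Delta> 0 = of_real (2 * \<nu> * g1 * g2 / real (Suc n))" .
    moreover have "2 * \<nu> * g1 * g2 / real (Suc n) \<noteq> 0" using pos \<nu> by simp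
    ultimately show ?thesis by (metis of_real_eq_0_iff)
  qed
  hence \<Delta>0: "\<Delta> \<noteq> 0" by auto
  define M :: real where "M = 4 ^ (Suc n) + 4 ^ n"
  have bound: "cmod (poly \<Delta> (cis \<eta>)) \<le> M * \<eta> ^ (2*n+1)" if \<eta>: "0 \<le> \<eta>" "\<eta> \<le> 1" for \<eta>
  proof -
    define z where "z = cis \<eta>"
    define c where "c = cis (\<eta> / real r)"
    have rem: "cmod (poly (p k) z - c * poly (q k) z) \<le> \<eta> ^ (2*k+1)" for k
    proof -
      have "cmod (poly (p k) z - c * poly (q k) z) \<le> \<nu> * \<eta> ^ (2*k+1)"
        using pade_remainder_le[OF r, of k "\<eta> / real r"] r \<eta> by (simp add: poly_p poly_q z_def c_def \<nu>_def)
      also have "\<dots> \<le> 1 * \<eta> ^ (2*k+1)" using \<nu> \<eta> by (intro mult_right_mono) auto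
      finally show ?thesis by simp
    qed
    have q_le: "cmod (poly (q k) z) \<le> 4 ^ k" for k
      using norm_pade_le[OF \<nu>, of z 1 1 k] by (simp add: poly_q z_def)
    have "poly \<Delta> z = (poly (p n) z - c * poly (q n) z) * poly (q (Suc n)) z -
        (poly (p (Suc n)) z - c * poly (q (Suc n)) z) * poly (q n) z"
      by (simp add: \<Delta>_def algebra_simps)
    hence "cmod (poly \<Delta> z) \<le> cmod (poly (p n) z - c * poly (q n) z) * cmod (poly (q (Suc n)) z) +
       cmod (poly (p (Suc n)) z - c * poly (q (Suc n)) z) * cmod (poly (q n) z)"
      by (simp only: norm_mult[symmetric] norm_triangle_ineq4)
    also have "\<dots> \<le> \<eta> ^ (2*n+1) * 4 ^ Suc n + \<eta> ^ (2*n+1) * 4 ^ n"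
    proof (intro add_mono mult_mono rem q_le)
      have "cmod (poly (p (Suc n)) z - c * poly (q (Suc n)) z) \<le> \<eta> ^ (2 * Suc n + 1)" by (rule rem)
      also have "\<dots> \<le> \<eta> ^ (2*n+1)" using \<eta> by (intro power_decreasing) auto
      finally show "cmod (poly (p (Suc n)) z - c * poly (q (Suc n)) z) \<le> \<eta> ^ (2*n+1)" .
    qed (use \<eta> in auto)
    finally show ?thesis by (simp add: M_def z_def algebra_simps)
  qed
  obtain E where E: "\<Delta> = [:- 1, 1:] ^ order 1 \<Delta> * E" "\<not> [:- 1, 1:] dvd E"
    using order_decomp[OF \<Delta>0, of 1] by auto
  define k where "k = order 1 \<Delta>"
  have poly\<Delta>: "poly \<Delta> z = (z - 1) ^ k * poly E z" for z
    by (subst E(1)) (simp add: k_def poly_power)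
  have E1: "poly E 1 \<noteq> 0" using E(2) by (simp add: poly_eq_0_iff_dvd)
  \<comment> \<open>If the order were smaller, the cofactor \<open>E\<close> would tend to \<open>0\<close> as \<open>w\<close> tends to \<open>1\<close> along the unit circle.\<close>
  have "k \<ge> 2*n+1"
  proof (rule ccontr)
    assume "\<not> k \<ge> 2*n+1"
    hence k: "k \<le> 2*n" by simp
    have E_le: "cmod (poly E (cis \<eta>)) \<le> M * 2 ^ k * \<eta>" if \<eta>: "0 < \<eta>" "\<eta> \<le> 1" for \<eta>
    proof -
      have "\<eta> \<le> 2 * cmod (1 - cis \<eta>)" using abs_le_norm_cis_minus_one[of \<eta>] \<eta> pi_gt3 by simp
      hence "\<eta> / 2 \<le> cmod (cis \<eta> - 1)" by (simp add: norm_minus_commute)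
      hence "(\<eta> / 2) ^ k * cmod (poly E (cis \<eta>)) \<le> cmod (cis \<eta> - 1) ^ k * cmod (poly E (cis \<eta>))"
        using \<eta> by (intro mult_right_mono power_mono) auto
      also have "\<dots> \<le> M * \<eta> ^ (2*n+1)"
        using bound[of \<eta>] \<eta> by (simp add: poly\<Delta> norm_mult norm_power)
      also have "\<dots> \<le> M * (\<eta> ^ k * \<eta>)"
      proof (intro mult_left_mono)
        show "\<eta> ^ (2*n+1) \<le> \<eta> ^ k * \<eta>" using \<eta> k power_decreasing[of "k+1" "2*n+1" \<eta>] by (simp add: mult.commute)
      qed (simp add: M_def)
      finally have "\<eta> ^ k * cmod (poly E (cis \<eta>)) \<le> \<eta> ^ k * (M * 2 ^ k * \<eta>)"
        by (simp add: power_divide field_simps)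
      thus ?thesis using \<eta> by simp
    qed
    define \<eta> :: "nat \<Rightarrow> real" where "\<eta> m = 1 / real (Suc m)" for m
    have \<eta>_lim: "\<eta> \<longlonglongrightarrow> 0" unfolding \<eta>_def using LIMSEQ_inverse_real_of_nat by (simp add: inverse_eq_divide)
    have "(\<lambda>m. poly E (cis (\<eta> m))) \<longlonglongrightarrow> poly E (cis 0)"
      unfolding cis_conv_exp by (intro tendsto_intros \<eta>_lim)
    moreover have "(\<lambda>m. poly E (cis (\<eta> m))) \<longlonglongrightarrow> 0"
    proof (rule Lim_null_comparison)
      show "\<forall>\<^sub>F m in sequentially. norm (poly E (cis (\<eta> m))) \<le> M * 2 ^ k * \<eta> m"
        by (intro always_eventually allI E_le) (auto simp: \<eta>_def)
      show "(\<lambda>m. M * 2 ^ k * \<eta> m) \<longlonglongrightarrow> 0"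
        using tendsto_mult_left[OF \<eta>_lim, of "M * 2 ^ k"] by simp
    qed
    ultimately have "poly E (cis 0) = 0" by (rule LIMSEQ_unique)
    thus False using E1 by simp
  qed
  moreover have "degree \<Delta> = k + degree E"
  proof -
    have "E \<noteq> 0" using E1 by auto
    thus ?thesis by (subst E(1)) (simp add: degree_mult_eq degree_power_eq k_def)
  qed
  ultimately have "degree E = 0" using deg\<Delta> by simp
  then obtain e where "E = [:e:]" by (meson degree_eq_zeroE)
  hence "poly E w \<noteq> 0" using E1 by simp
  hence "poly \<Delta> w \<noteq> 0" using w by (simp add: poly\<Delta>)
  thus ?thesis by (simp add: \<Delta>_def poly_p poly_q)
qed

lemma pade_homogeneous: "pade \<nu> n (c * X) (c * Y) = c ^ n * pade \<nu> n X Y"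
proof -
  have "c ^ l * c ^ (n - l) = c ^ n" if "l \<le> n" for l using that by (simp flip: power_add)
  thus ?thesis unfolding pade_def sum_distrib_left
    by (intro sum.cong refl) (simp add: power_mult_distrib mult_ac)
qed

lemma pade_approximation:
  fixes r n :: nat and u v :: complex and \<phi> :: real
  defines "\<nu> \<equiv> 1 / real r"
  assumes "r \<ge> 2" and v: "v = u * cis \<phi>"
  shows "cmod (u * pade \<nu> n (u ^ r) (v ^ r) - v * pade \<nu> n (v ^ r) (u ^ r))
     \<le> cmod u ^ (r * n + 1) * (\<nu> * (real r * \<bar>\<phi>\<bar>) ^ (2*n+1))"
proof -
  define w where "w = cis (real r * \<phi>)"
  have vr: "v ^ r = u ^ r * w" by (simp add: v w_def power_mult_distrib Complex.DeMoivre)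
  have "pade \<nu> n (u ^ r) (v ^ r) = u ^ (r*n) * pade \<nu> n 1 w"
    using pade_homogeneous[of \<nu> n "u ^ r" 1 w] by (simp add: vr power_mult)
  moreover have "pade \<nu> n (v ^ r) (u ^ r) = u ^ (r*n) * pade \<nu> n w 1"
    using pade_homogeneous[of \<nu> n "u ^ r" w 1] by (simp add: vr power_mult)
  ultimately have "u * pade \<nu> n (u ^ r) (v ^ r) - v * pade \<nu> n (v ^ r) (u ^ r) =
     u ^ (r * n + 1) * (pade \<nu> n 1 w - cis \<phi> * pade \<nu> n w 1)"
    by (simp add: v algebra_simps)
  thus ?thesis using pade_remainder_le[OF \<open>r \<ge> 2\<close>, of n \<phi>]
    by (simp add: norm_mult norm_power w_def \<nu>_def mult_left_mono)
qed

text \<open>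
  Two consecutive approximants are different fractions at every point off the diagonal. This is what
  keeps one of the two auxiliary numbers built from them from vanishing.
\<close>

lemma pade_cross_products_distinct:
  fixes r n :: nat and X Y :: complex
  defines "\<nu> \<equiv> 1 / real r"
  assumes "r \<ge> 2" "X \<noteq> Y" "X \<noteq> 0"
  shows "pade \<nu> n X Y * pade \<nu> (Suc n) Y X \<noteq> pade \<nu> (Suc n) X Y * pade \<nu> n Y X"
proof -
  define w where "w = Y / X"
  have w: "w \<noteq> 1" "X * w = Y" using assms by (auto simp: w_def)
  have h: "pade \<nu> k X Y = X ^ k * pade \<nu> k 1 w" "pade \<nu> k Y X = X ^ k * pade \<nu> k w 1" for k
    using pade_homogeneous[of \<nu> k X 1 w] pade_homogeneous[of \<nu> k X w 1] w(2) by simp_all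
  show ?thesis using pade_det_nonzero[OF \<open>r \<ge> 2\<close> w(1), of n, folded \<nu>_def] \<open>X \<noteq> 0\<close>
    by (simp add: h)
qed

section \<open>Arithmetic of the linear factors\<close>

text \<open>
  The quadratic form is assumed to be
  primitive here; dividing it by its content changes neither the solutions nor the bound.
\<close>

locale reduced_diagonal_form =
  fixes r :: nat and F :: "nat \<Rightarrow> int" and \<alpha> \<beta> \<gamma> \<delta> \<kappa> :: complex and A B C :: int
  assumes degree: "r \<ge> 6"
    and diagonalization: "diagonalization r F \<alpha> \<beta> \<gamma> \<delta>"
    and quadratic: "\<And>x y. (\<alpha> * x + \<beta> * y) * (\<gamma> * x + \<delta> * y) =
        \<kappa> * (of_int A * x\<^sup>2 + of_int B * x * y + of_int C * y\<^sup>2)"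
    and negative: "B\<^sup>2 - 4 * A * C < 0"
    and reduced: "reduced_quadratic A B C"
    and content: "gcd A (gcd B C) = 1"
begin

text \<open>
  \<open>s\<close> is a square root of \<open>D\<close>, with the sign for which \<open>j = \<kappa> s\<close>, and \<open>\<sigma>\<close> generates the quadratic order of
  discriminant \<open>D\<close>.
\<close>

definition u where "u x y = \<alpha> * of_int x + \<beta> * of_int y"
definition v where "v x y = \<gamma> * of_int x + \<delta> * of_int y"
definition j where "j = \<alpha> * \<delta> - \<beta> * \<gamma>"
definition D where "D = B\<^sup>2 - 4 * A * C"
definition Q where "Q x y = A * x\<^sup>2 + B * x * y + C * y\<^sup>2"
definition s where "s = j / \<kappa>"
definition \<sigma> where "\<sigma> = (of_int B + s) / 2"

lemma D_neg: "D < 0" using negative by (simp add: D_def)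

lemma j_nonzero: "j \<noteq> 0" using diagonalization by (simp add: diagonalization_def j_def)

lemma coefficients:
  "\<alpha> * \<gamma> = \<kappa> * of_int A" "\<alpha> * \<delta> + \<beta> * \<gamma> = \<kappa> * of_int B" "\<beta> * \<delta> = \<kappa> * of_int C"
  using quadratic[of 1 0] quadratic[of 0 1] quadratic[of 1 1] by (simp_all add: algebra_simps)

lemma j_squared: "j\<^sup>2 = \<kappa>\<^sup>2 * of_int D"
proof -
  have "j\<^sup>2 = (\<alpha> * \<delta> + \<beta> * \<gamma>)\<^sup>2 - 4 * (\<alpha> * \<gamma>) * (\<beta> * \<delta>)"
    by (simp add: j_def power2_eq_square algebra_simps)
  thus ?thesis unfolding coefficients by (simp add: D_def power2_eq_square algebra_simps)
qed

lemma \<kappa>_nonzero: "\<kappa> \<noteq> 0" using j_squared j_nonzero by auto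

lemma s_squared: "s\<^sup>2 = of_int D"
  using j_squared \<kappa>_nonzero by (simp add: s_def power_divide)

lemma j_eq: "j = \<kappa> * s" using \<kappa>_nonzero by (simp add: s_def)

lemma s_nonzero: "s \<noteq> 0" using j_nonzero by (simp add: j_eq)

lemma cnj_s: "cnj s = - s"
proof -
  have "Re (s\<^sup>2) = of_int D" "Im (s\<^sup>2) = 0" by (simp_all add: s_squared)
  moreover have "real_of_int D < 0" using D_neg by simp
  ultimately have 1: "Re s * Re s - Im s * Im s < 0" "Re s * Im s = 0"
    by (simp_all only: power2_eq_square times_complex.sel) (simp_all add: mult.commute)
  have "Im s \<noteq> 0"
  proof
    assume "Im s = 0"
    with 1(1) show False by simp
  qed
  with 1(2) have "Re s = 0" by simp
  thus ?thesis by (simp add: complex_eq_iff)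
qed

lemma norm_s_squared: "(cmod s)\<^sup>2 = - of_int D"
proof -
  have "(cmod s)\<^sup>2 = cmod (s\<^sup>2)" by (simp add: norm_power)
  also have "\<dots> = \<bar>of_int D\<bar>" by (simp add: s_squared)
  finally show ?thesis using D_neg by simp
qed

lemma norm_j: "cmod j = cmod \<kappa> * cmod s" by (simp add: j_eq norm_mult)

lemma A_pos: "A > 0"
proof -
  have "A \<ge> 0" using reduced by (auto simp: reduced_quadratic_def)
  moreover have "A \<noteq> 0" using reduced D_neg by (auto simp: reduced_quadratic_def D_def)
  ultimately show ?thesis by simp
qed

lemma A_squared_le: "3 * A\<^sup>2 \<le> - D"
proof -
  have r: "\<bar>B\<bar> \<le> A" "A \<le> C" using reduced by (auto simp: reduced_quadratic_def)
  have "B\<^sup>2 \<le> A\<^sup>2" using power_mono[OF r(1), of 2] by simp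
  moreover have "A\<^sup>2 \<le> A * C" using r(2) A_pos by (simp add: power2_eq_square)
  ultimately show ?thesis by (simp add: D_def)
qed

lemma minus_D_ge: "- D \<ge> 3"
proof -
  have "A\<^sup>2 \<ge> 1" using A_pos by simp
  thus ?thesis using A_squared_le by linarith
qed

lemma Q_completed_square: "4 * A * Q x y = (2 * A * x + B * y)\<^sup>2 - D * y\<^sup>2"
  by (simp add: Q_def D_def power2_eq_square algebra_simps)

lemma Q_pos:
  assumes "(x, y) \<noteq> (0, 0)"
  shows "Q x y > 0"
proof -
  have "4 * A * Q x y > 0"
  proof (cases "y = 0")
    case True
    thus ?thesis using assms A_pos by (simp add: Q_completed_square)
  next
    case False
    hence "D * y\<^sup>2 < 0" using D_neg by (simp add: mult_neg_pos)
    moreover have "(2 * A * x + B * y)\<^sup>2 \<ge> 0" by simp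
    ultimately show ?thesis unfolding Q_completed_square by linarith
  qed
  thus ?thesis using A_pos by (simp add: zero_less_mult_iff)
qed

lemma Q_pos_coprime: "coprime x y \<Longrightarrow> Q x y > 0"
  by (rule Q_pos) auto

lemma u_times_v: "u x y * v x y = \<kappa> * of_int (Q x y)"
  using quadratic[of "of_int x" "of_int y"] by (simp add: u_def v_def Q_def)

lemma form_eq: "of_int (form_eval r F x y) = u x y ^ r - v x y ^ r"
proof -
  have "of_int (form_eval r F x y) = form_eval r F (of_int x :: complex) (of_int y)"
    by (simp add: form_eval_def)
  thus ?thesis using diagonalization by (simp add: diagonalization_def u_def v_def)
qed

text \<open>
  The order \<open>\<int>[\<sigma>]\<close> of the imaginary quadratic field. A nonzero element of the form \<open>z - cnj z\<close> has absolute
  value at least \<open>|s|\<close>; this replaces the fact that a nonzero integer is at least \<open>1\<close> in absolute value.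
\<close>

definition quad_ring :: "complex set" where
  "quad_ring = {of_int a + of_int b * \<sigma> | a b. True}"

lemma \<sigma>_squared: "\<sigma>\<^sup>2 = of_int B * \<sigma> - of_int (A * C)"
proof -
  have "4 * \<sigma>\<^sup>2 = (of_int B + s)\<^sup>2" by (simp add: \<sigma>_def power_divide)
  also have "\<dots> = of_int B * of_int B + 2 * of_int B * s + s\<^sup>2" by (simp add: power2_eq_square algebra_simps)
  also have "\<dots> = 4 * (of_int B * \<sigma> - of_int (A * C))"
    unfolding s_squared by (simp add: D_def \<sigma>_def power2_eq_square field_simps)
  finally show ?thesis by (simp only: mult_cancel_left) simp
qed

lemma cnj_\<sigma>: "cnj \<sigma> = of_int B - \<sigma>" by (simp add: \<sigma>_def cnj_s field_simps)

lemma quad_ringI: "of_int a + of_int b * \<sigma> \<in> quad_ring" by (auto simp: quad_ring_def)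

lemma of_int_quad_ring: "of_int a \<in> quad_ring" using quad_ringI[of a 0] by simp

lemma quad_ring_add: "z \<in> quad_ring \<Longrightarrow> w \<in> quad_ring \<Longrightarrow> z + w \<in> quad_ring"
proof -
  assume "z \<in> quad_ring" "w \<in> quad_ring"
  then obtain a b c d where "z = of_int a + of_int b * \<sigma>" "w = of_int c + of_int d * \<sigma>"
    by (auto simp: quad_ring_def)
  hence "z + w = of_int (a + c) + of_int (b + d) * \<sigma>" by (simp add: algebra_simps)
  thus ?thesis by (simp only: quad_ringI)
qed

lemma quad_ring_mult: "z \<in> quad_ring \<Longrightarrow> w \<in> quad_ring \<Longrightarrow> z * w \<in> quad_ring"
proof -
  assume "z \<in> quad_ring" "w \<in> quad_ring"
  then obtain a b c d where *: "z = of_int a + of_int b * \<sigma>" "w = of_int c + of_int d * \<sigma>"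
    by (auto simp: quad_ring_def)
  hence "z * w = of_int a * of_int c + (of_int a * of_int d + of_int b * of_int c) * \<sigma> + of_int b * of_int d * \<sigma>\<^sup>2"
    by (simp add: algebra_simps power2_eq_square)
  also have "\<dots> = of_int (a * c - b * d * (A * C)) + of_int (a * d + b * c + b * d * B) * \<sigma>"
    unfolding \<sigma>_squared by (simp add: algebra_simps)
  finally show ?thesis by (simp only: quad_ringI)
qed

lemma quad_ring_power: "z \<in> quad_ring \<Longrightarrow> z ^ n \<in> quad_ring"
  by (induction n) (use of_int_quad_ring[of 1] quad_ring_mult in auto)

lemma quad_ring_sum: "(\<And>i. i \<in> I \<Longrightarrow> f i \<in> quad_ring) \<Longrightarrow> sum f I \<in> quad_ring"
  by (induction I rule: infinite_finite_induct) (use of_int_quad_ring[of 0] quad_ring_add in auto)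

lemma quad_ring_cnj: "z \<in> quad_ring \<Longrightarrow> cnj z \<in> quad_ring"
proof -
  assume "z \<in> quad_ring"
  then obtain a b where "z = of_int a + of_int b * \<sigma>" by (auto simp: quad_ring_def)
  hence "cnj z = of_int (a + b * B) + of_int (- b) * \<sigma>" by (simp add: cnj_\<sigma> algebra_simps)
  thus ?thesis by (simp only: quad_ringI)
qed

lemma quad_ring_minus_cnj:
  assumes "z \<in> quad_ring"
  obtains b :: int where "z - cnj z = of_int b * s"
proof -
  obtain a b where "z = of_int a + of_int b * \<sigma>" using assms by (auto simp: quad_ring_def)
  hence "z - cnj z = of_int b * s" by (simp add: cnj_\<sigma> algebra_simps) (simp add: \<sigma>_def field_simps)
  thus thesis by (rule that)
qed

lemma quad_ring_norm_integral:
  assumes "z \<in> quad_ring"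
  shows "(cmod z)\<^sup>2 \<in> \<int>"
proof -
  obtain a b where z: "z = of_int a + of_int b * \<sigma>" using assms by (auto simp: quad_ring_def)
  have "complex_of_real ((cmod z)\<^sup>2) = z * cnj z" by (rule complex_norm_square)
  also have "\<dots> = of_int a * of_int a + of_int a * of_int b * of_int B + of_int b * of_int b * (of_int B * \<sigma> - \<sigma>\<^sup>2)"
    by (simp add: z cnj_\<sigma> power2_eq_square algebra_simps)
  also have "\<dots> = of_real (of_int (a * a + a * b * B + b * b * (A * C)))"
    unfolding \<sigma>_squared by simp
  finally have "(cmod z)\<^sup>2 = of_int (a * a + a * b * B + b * b * (A * C))" by (simp only: of_real_eq_iff)
  thus ?thesis by (simp only: Ints_of_int)
qed

text \<open>
  The directional derivatives of a form with integral coefficients are integers at integral points.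
\<close>

lemma directional_derivative_integral:
  fixes x y p q :: int
  obtains G :: int where
    "of_nat r * (u x y ^ (r-1) * u p q - v x y ^ (r-1) * v p q) = of_int G"
proof -
  define G where "G = (\<Sum>i\<le>r. F i * (int (r - i) * x ^ (r - i - 1) * p * y ^ i + x ^ (r - i) * (int i * y ^ (i - 1) * q)))"
  have d1: "((\<lambda>t. form_eval r F (of_int x + t * of_int p) (of_int y + t * of_int q) :: complex)
      has_field_derivative of_int G) (at 0)"
    unfolding form_eval_def G_def
    by (auto intro!: derivative_eq_intros simp: algebra_simps)
  have eq: "(\<lambda>t. form_eval r F (of_int x + t * of_int p) (of_int y + t * of_int q) :: complex) =
     (\<lambda>t. (u x y + t * u p q) ^ r - (v x y + t * v p q) ^ r)"
  proof
    fix t :: complex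
    have "\<alpha> * (of_int x + t * of_int p) + \<beta> * (of_int y + t * of_int q) = u x y + t * u p q"
      "\<gamma> * (of_int x + t * of_int p) + \<delta> * (of_int y + t * of_int q) = v x y + t * v p q"
      by (simp_all add: u_def v_def algebra_simps)
    thus "form_eval r F (of_int x + t * of_int p) (of_int y + t * of_int q) =
        (u x y + t * u p q) ^ r - (v x y + t * v p q) ^ r"
      using diagonalization by (simp add: diagonalization_def)
  qed
  have d2: "((\<lambda>t. (u x y + t * u p q) ^ r - (v x y + t * v p q) ^ r) has_field_derivative
     of_nat r * (u x y ^ (r-1) * u p q - v x y ^ (r-1) * v p q)) (at 0)"
    by (auto intro!: derivative_eq_intros simp: algebra_simps)
  have "of_nat r * (u x y ^ (r-1) * u p q - v x y ^ (r-1) * v p q) = of_int G"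
    by (rule DERIV_unique [OF d2 d1 [unfolded eq]])
  thus thesis by (rule that)
qed

text \<open>
  The number \<open>U = u ^ r\<close> is determined by \<open>U - V\<close>, which is a value of the form, and \<open>U + V\<close>. Complete
  \<open>(x, y)\<close> to a basis of \<open>\<int>\<^sup>2\<close> by some \<open>(p, q)\<close>: the derivative of the form in the direction \<open>(p, q)\<close> is a
  second integral linear relation between \<open>U\<close> and \<open>V\<close>, and it shows that \<open>r s (U + V)\<close> is an integer.
  Since \<open>s\<close> is purely imaginary, complex conjugation changes the sign of \<open>U + V\<close> and fixes \<open>U - V\<close>.
\<close>

lemma resolvent:
  fixes x y :: int
  assumes "coprime x y"
  shows "of_nat r * s * u x y ^ r \<in> quad_ring" and "cnj (u x y ^ r) = - (v x y ^ r)"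
proof -
  obtain a b where ab: "a * x + b * y = 1"
    using bezout_int[of x y] assms by (auto simp: coprime_iff_gcd_eq_1)
  define p q where "p = - b" and "q = a"
  have pq: "x * q - y * p = 1" using ab by (simp add: p_def q_def mult.commute)
  obtain G :: int where G: "of_nat r * (u x y ^ (r-1) * u p q - v x y ^ (r-1) * v p q) = of_int G"
    by (rule directional_derivative_integral)
  define U V where "U = u x y ^ r" and "V = v x y ^ r"
  define F0 where "F0 = form_eval r F x y"
  have F0: "U - V = of_int F0" by (simp add: F0_def U_def V_def form_eq)
  define H where "H = A * x * p + B * y * p + C * y * q"
  \<comment> \<open>\<open>B'\<close> is the middle coefficient of the quadratic form in the basis \<open>(x, y)\<close>, \<open>(p, q)\<close>.\<close>
  define B' where "B' = 2 * H + B"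

  have minus: "u x y * v p q - u p q * v x y = \<kappa> * s"
  proof -
    have "u x y * v p q - u p q * v x y = j * of_int (x * q - y * p)"
      by (simp add: u_def v_def j_def algebra_simps)
    thus ?thesis by (simp add: pq j_eq)
  qed
  have plus: "u x y * v p q + u p q * v x y = \<kappa> * of_int B'"
  proof -
    have "u x y * v p q + u p q * v x y =
       2 * (\<alpha> * \<gamma>) * of_int (x * p) + (\<alpha> * \<delta> + \<beta> * \<gamma>) * of_int (x * q + y * p) + 2 * (\<beta> * \<delta>) * of_int (y * q)"
      by (simp add: u_def v_def algebra_simps)
    also have "x * q + y * p = 2 * (y * p) + 1" using pq by linarith
    finally show ?thesis unfolding coefficients by (simp add: B'_def H_def algebra_simps)
  qed
  have uv': "2 * (u x y * v p q) = \<kappa> * (of_int B' + s)" and u'v: "2 * (u p q * v x y) = \<kappa> * (of_int B' - s)"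
  proof -
    have "2 * (u x y * v p q) = (u x y * v p q + u p q * v x y) + (u x y * v p q - u p q * v x y)"
      and "2 * (u p q * v x y) = (u x y * v p q + u p q * v x y) - (u x y * v p q - u p q * v x y)" by simp_all
    thus "2 * (u x y * v p q) = \<kappa> * (of_int B' + s)" and "2 * (u p q * v x y) = \<kappa> * (of_int B' - s)"
      unfolding plus minus by (simp_all add: algebra_simps)
  qed
  have "of_nat r * (U * (u p q * v x y) - V * (u x y * v p q)) = of_int G * (u x y * v x y)"
  proof -
    have "U = u x y ^ (r-1) * u x y" "V = v x y ^ (r-1) * v x y"
      using degree by (simp_all add: U_def V_def flip: power_Suc2)
    thus ?thesis unfolding G[symmetric] by (simp add: algebra_simps)
  qed
  moreover have "2 * (of_nat r * (U * (u p q * v x y) - V * (u x y * v p q))) =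
      of_nat r * (U * (2 * (u p q * v x y)) - V * (2 * (u x y * v p q)))" by (simp add: algebra_simps)
  ultimately have "of_nat r * (U * (\<kappa> * (of_int B' - s)) - V * (\<kappa> * (of_int B' + s))) = 2 * (of_int G * (\<kappa> * of_int (Q x y)))"
    unfolding uv' u'v u_times_v by simp
  hence "\<kappa> * (of_nat r * (U * (of_int B' - s) - V * (of_int B' + s))) = \<kappa> * (2 * (of_int G * of_int (Q x y)))"
    by (simp add: algebra_simps)
  hence "of_nat r * (U * (of_int B' - s) - V * (of_int B' + s)) = 2 * of_int G * of_int (Q x y)"
    using \<kappa>_nonzero by simp
  moreover have "of_nat r * s * (U + V) = of_nat r * ((U - V) * of_int B') - of_nat r * (U * (of_int B' - s) - V * (of_int B' + s))"
    by (simp add: algebra_simps)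
  ultimately have "of_nat r * s * (U + V) = of_nat r * (of_int F0 * of_int B') - 2 * of_int G * of_int (Q x y)"
    by (simp only: F0)
  hence W: "of_nat r * s * (U + V) = of_int (int r * F0 * B' - 2 * G * Q x y)" by simp
  have "2 * (of_nat r * s * U) = of_nat r * s * (U + V) + of_nat r * s * (U - V)" by (simp add: algebra_simps)
  also have "\<dots> = of_int (int r * F0 * B' - 2 * G * Q x y) + of_nat r * s * of_int F0" by (simp only: W F0)
  also have "\<dots> = of_int (2 * (int r * F0 * H - G * Q x y)) + of_int (int r * F0) * (of_int B + s)"
    by (simp add: B'_def H_def algebra_simps)
  also have "\<dots> = 2 * (of_int (int r * F0 * H - G * Q x y) + of_int (int r * F0) * \<sigma>)"
    by (simp add: \<sigma>_def distrib_left)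
  finally have "of_nat r * s * U = of_int (int r * F0 * H - G * Q x y) + of_int (int r * F0) * \<sigma>"
    by (simp only: mult_cancel_left) simp
  thus "of_nat r * s * u x y ^ r \<in> quad_ring" unfolding U_def by (simp only: quad_ringI)
  define w where "w = U + V"
  have "cnj (of_nat r * s * w) = of_nat r * s * w" unfolding w_def W by simp
  moreover have "cnj (of_nat r * s * w) = of_nat r * (- s) * cnj w" by (simp add: cnj_s)
  moreover have "of_nat r * s * (cnj w + w) = of_nat r * s * w - of_nat r * (- s) * cnj w"
    by (simp add: algebra_simps)
  ultimately have "of_nat r * s * (cnj w + w) = 0" by (simp only: diff_self)
  hence "cnj w + w = 0" using s_nonzero degree by (simp only: mult_eq_0_iff of_nat_eq_0_iff) auto
  hence "cnj (U + V) = - (U + V)" by (simp add: w_def add_eq_0_iff2)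
  moreover have "cnj (U - V) = U - V" unfolding F0 by simp
  ultimately have "cnj U + cnj V = - U - V" "cnj U - cnj V = U - V" by simp_all
  moreover have "2 * cnj U = (cnj U + cnj V) + (cnj U - cnj V)" by simp
  ultimately have "2 * cnj U = 2 * (- V)" by simp
  hence "cnj U = - V" by (simp only: mult_cancel_left) simp
  thus "cnj (u x y ^ r) = - (v x y ^ r)" by (simp add: U_def V_def)
qed

lemma norm_v:
  assumes "coprime x y" shows "cmod (v x y) = cmod (u x y)"
proof -
  have "cmod (v x y) ^ r = cmod (u x y) ^ r"
    using resolvent(2)[OF assms] by (metis complex_mod_cnj norm_minus_cancel norm_power)
  from power_eq_imp_eq_base[OF this] show ?thesis using degree by simp
qed

lemma norm_u_squared:
  assumes "coprime x y" shows "(cmod (u x y))\<^sup>2 = cmod \<kappa> * of_int (Q x y)"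
proof -
  have "(cmod (u x y))\<^sup>2 = cmod (u x y * v x y)" by (simp add: norm_mult norm_v[OF assms] power2_eq_square)
  also have "\<dots> = cmod \<kappa> * \<bar>of_int (Q x y)\<bar>" unfolding u_times_v by (simp add: norm_mult)
  also have "\<bar>real_of_int (Q x y)\<bar> = of_int (Q x y)" using Q_pos_coprime[OF assms] by simp
  finally show ?thesis .
qed

lemma norm_resolvent_integral:
  assumes "coprime x y"
  shows "(real r)\<^sup>2 * - of_int D * cmod \<kappa> ^ r * of_int (Q x y) ^ r \<in> \<int>"
proof -
  have "(cmod (of_nat r * s * u x y ^ r))\<^sup>2 = (real r)\<^sup>2 * (cmod s)\<^sup>2 * ((cmod (u x y))\<^sup>2) ^ r"
  proof -
    have "(a * b * c ^ r)\<^sup>2 = a\<^sup>2 * b\<^sup>2 * (c\<^sup>2) ^ r" for a b c :: real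
      unfolding power_mult_distrib power_mult[symmetric] by (simp only: mult.commute)
    thus ?thesis by (simp add: norm_mult norm_power)
  qed
  also have "\<dots> = (real r)\<^sup>2 * - of_int D * cmod \<kappa> ^ r * of_int (Q x y) ^ r"
    unfolding norm_s_squared norm_u_squared[OF assms] by (simp add: power_mult_distrib)
  finally show ?thesis using quad_ring_norm_integral[OF resolvent(1)[OF assms]] by simp
qed

text \<open>
  Let \<open>\<tau>\<close> be the quantity on the left. The norm of \<open>r s u ^ r\<close> at a primitive point is \<open>\<tau> Q(x, y) ^ r\<close> and an
  integer. The values \<open>A\<close>, \<open>C\<close> and \<open>A + B + C\<close> of the primitive form \<open>Q\<close> have no common factor, so \<open>\<tau>\<close> itself
  is an integer; and it is positive.
\<close>

lemma resolvent_content_ge_1: "(real r)\<^sup>2 * - of_int D * cmod \<kappa> ^ r \<ge> 1"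
proof -
  define \<tau> where "\<tau> = (real r)\<^sup>2 * - of_int D * cmod \<kappa> ^ r"
  have int: "\<tau> * of_int (Q x y ^ r) \<in> \<int>" if "coprime x y" for x y
    using norm_resolvent_integral[OF that] by (simp only: \<tau>_def of_int_power)
  have "Q 1 0 = A" "Q 0 1 = C" "Q 1 1 = A + B + C" by (simp_all add: Q_def)
  with int[of 1 0] int[of 0 1] int[of 1 1]
  have ints: "\<tau> * of_int (A ^ r) \<in> \<int>" "\<tau> * of_int (C ^ r) \<in> \<int>" "\<tau> * of_int ((A + B + C) ^ r) \<in> \<int>"
    by (simp_all only: coprime_1_left coprime_1_right coprime_0_left_iff is_unit_gcd)
  define g where "g = gcd (C ^ r) ((A + B + C) ^ r)"
  have coprime: "gcd (A ^ r) g = 1"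
  proof -
    have "coprime A (gcd C (A + B + C))"
    proof (rule coprimeI)
      fix d assume d: "d dvd A" "d dvd gcd C (A + B + C)"
      hence "d dvd C" "d dvd A + B + C" by simp_all
      hence "d dvd (A + B + C) - (A + C)"
        using d(1) dvd_diff[of d "A + B + C" "A + C"] dvd_add[of d A C] by blast
      moreover have "(A + B + C) - (A + C) = B" by simp
      ultimately have "d dvd B" by (simp only:)
      hence "d dvd gcd A (gcd B C)" using d(1) \<open>d dvd C\<close> by simp
      thus "is_unit d" by (simp add: content)
    qed
    hence "coprime (A ^ r) (gcd C (A + B + C) ^ r)" by simp
    thus ?thesis by (simp only: coprime_iff_gcd_eq_1 g_def gcd_exp)
  qed
  obtain a b where ab: "a * A ^ r + b * g = gcd (A ^ r) g"
    using bezout_int by blast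
  obtain c d where cd: "c * C ^ r + d * (A + B + C) ^ r = g"
    unfolding g_def using bezout_int by blast
  have "\<tau> = \<tau> * of_int (a * A ^ r + b * (c * C ^ r + d * (A + B + C) ^ r))"
    unfolding cd ab coprime by simp
  also have "\<dots> = of_int a * (\<tau> * of_int (A ^ r)) + of_int b * (of_int c * (\<tau> * of_int (C ^ r)) +
      of_int d * (\<tau> * of_int ((A + B + C) ^ r)))" by (simp add: algebra_simps)
  also have "\<dots> \<in> \<int>" by (intro Ints_add Ints_mult ints Ints_of_int)
  finally have "\<tau> \<in> \<int>" .
  then obtain k :: int where k: "\<tau> = of_int k" by (auto simp: Ints_def)
  have "- real_of_int D > 0" using D_neg by simp
  hence "\<tau> > 0" unfolding \<tau>_def using \<kappa>_nonzero degree by (intro mult_pos_pos) auto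
  hence "\<tau> \<ge> 1" unfolding k by simp
  thus ?thesis by (simp add: \<tau>_def)
qed

text \<open>
  The discriminant is bounded in terms of \<open>j\<close>. This makes the denominators \<open>s ^ n\<close> of the Pade method
  harmless compared with powers of a large solution.
\<close>

lemma norm_s_power_le: "cmod s ^ (r - 2) \<le> (real r)\<^sup>2 * cmod j ^ r"
proof -
  have "r = 2 + (r - 2)" using degree by simp
  hence e: "cmod s ^ r = (cmod s)\<^sup>2 * cmod s ^ (r - 2)" by (metis power_add)
  have "cmod s ^ (r - 2) * 1 \<le> cmod s ^ (r - 2) * ((real r)\<^sup>2 * - of_int D * cmod \<kappa> ^ r)"
    by (intro mult_left_mono resolvent_content_ge_1) auto
  also have "\<dots> = (real r)\<^sup>2 * cmod j ^ r"
    by (simp add: norm_j power_mult_distrib e norm_s_squared)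
  finally show ?thesis by simp
qed

end

section \<open>Estimates for a pair of solutions\<close>

lemma square_less_power_9_4:
  assumes "r \<ge> 6" shows "(real r)\<^sup>2 < (9/4) ^ (r - 1)"
  using assms
proof (induction r rule: nat_induct_at_least)
  case base
  show ?case by (simp add: power2_eq_square eval_nat_numeral)
next
  case (Suc n)
  have "1 / real n \<le> 1 / 6" using Suc by (simp add: divide_simps)
  hence "(real (Suc n) / real n)\<^sup>2 \<le> (7/6)\<^sup>2" using Suc by (intro power_mono) (auto simp: field_simps)
  also have "\<dots> \<le> (9/4 :: real)" by (simp add: power2_eq_square)
  finally have "(real (Suc n))\<^sup>2 \<le> 9/4 * (real n)\<^sup>2" using Suc by (simp add: power_divide field_simps)
  also have "\<dots> < 9/4 * (9/4) ^ (n - 1)" using Suc by simp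
  also have "\<dots> = (9/4) ^ (Suc n - 1)" using Suc by (simp flip: power_Suc)
  finally show ?case .
qed

text \<open>
  The choice of the order of approximation. The first family of inequalities says that the approximants
  of order \<open>k\<close> at the smaller solution, of size \<open>T\<close>, are precise enough to detect the larger one, of size
  \<open>S\<close>; the second that their values are still small compared with \<open>S ^ (r - 1)\<close>. Take the least \<open>n\<close> for which the
  first holds. It is not \<open>0\<close> because of the gap between \<open>T\<close> and \<open>S\<close>, and failure at \<open>n - 1\<close> makes \<open>S\<close> at
  least \<open>T ^ ((r - 2) n)\<close>; then \<open>S ^ (r - 1)\<close> dominates, as \<open>(r - 1) (r - 2) n\<close> exceeds
  \<open>(r + 1) (n + 1) + 1\<close> for \<open>r \<ge> 6\<close>. Both inequalities are needed for two consecutive orders.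
\<close>

lemma approximation_order_exists:
  fixes T S h E J :: real and r :: nat
  assumes r: "r \<ge> 6" and h: "h \<ge> 1" and T2: "2 * h \<le> T" and E: "E \<ge> 1" and TE: "E * h \<le> T"
    and J: "J \<ge> 2/3" and S: "S > 0" and gap: "J * T ^ (r - 1) \<le> h * S"
  obtains n where "\<And>k. k \<in> {n, Suc n} \<Longrightarrow> E ^ k * h ^ (2*k+1) * S < J * T ^ (r*(k+1) - 1)"
    and "\<And>k. k \<in> {n, Suc n} \<Longrightarrow> E ^ k * h * T ^ (r*k+1) < J * S ^ (r - 1)"
proof -
  define P where "P n \<longleftrightarrow> E ^ n * h ^ (2*n+1) * S < J * T ^ (r*(n+1) - 1)" for n
  have T: "T \<ge> 2" using T2 h by linarith
  have Eh2: "E * h\<^sup>2 * 2 \<le> T ^ r"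
  proof -
    have "E * h\<^sup>2 * 2 = (E * h) * (2 * h)" by (simp add: power2_eq_square)
    also have "\<dots> \<le> T * T" using TE T2 h E by (intro mult_mono) auto
    also have "\<dots> = T ^ 2" by (simp add: power2_eq_square)
    also have "\<dots> \<le> T ^ r" using T r by (intro power_increasing) auto
    finally show ?thesis .
  qed
  have step: "2 * (E ^ Suc n * h ^ (2*Suc n+1) * S) / T ^ (r*(Suc n+1) - 1) \<le> E ^ n * h ^ (2*n+1) * S / T ^ (r*(n+1) - 1)" for n
  proof -
    have e: "T ^ (r*(Suc n+1) - 1) = T ^ (r*(n+1) - 1) * T ^ r"
      using r by (simp flip: power_add add: algebra_simps)
    have "2 * (E ^ Suc n * h ^ (2*Suc n+1) * S) = (E ^ n * h ^ (2*n+1) * S) * (E * h\<^sup>2 * 2)"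
      by (simp add: power2_eq_square)
    also have "\<dots> \<le> (E ^ n * h ^ (2*n+1) * S) * T ^ r"
      using Eh2 E h S by (intro mult_left_mono) auto
    finally show ?thesis using T unfolding e by (simp add: field_simps)
  qed
  define a where "a n = E ^ n * h ^ (2*n+1) * S / T ^ (r*(n+1) - 1)" for n
  have P_a: "P n \<longleftrightarrow> a n < J" for n using T by (simp add: P_def a_def field_simps)
  have a_step: "2 * a (Suc n) \<le> a n" for n using step[of n] by (simp add: a_def)
  have a_pos: "a n > 0" for n using E h S T by (simp add: a_def)
  have "2 ^ n * a n \<le> a 0" for n
  proof (induction n)
    case (Suc n)
    have "2 ^ Suc n * a (Suc n) = 2 ^ n * (2 * a (Suc n))" by simp
    also have "\<dots> \<le> 2 ^ n * a n" by (intro mult_left_mono a_step) auto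
    also note Suc
    finally show ?case .
  qed simp
  moreover obtain N where N: "a 0 / J < 2 ^ N" using real_arch_pow[of 2] by auto
  moreover have "a 0 < 2 ^ N * J" using N J by (simp add: divide_less_eq)
  ultimately have "2 ^ N * a N < 2 ^ N * J" by (meson order_le_less_trans)
  hence "P N" by (simp add: P_a)
  hence PL: "P (LEAST n. P n)" by (rule LeastI)
  have "\<not> P 0" using gap by (simp add: P_def not_less)
  then obtain m where m: "(LEAST n. P n) = Suc m" using PL by (metis not0_implies_Suc)
  hence "\<not> P m" by (intro not_less_Least) simp
  hence "J * T ^ (r*(m+1) - 1) \<le> E ^ m * h ^ (2*m+1) * S" by (simp add: P_def)
  also have "E ^ m * h ^ (2*m+1) = (E * h) ^ m * h ^ m * h" by (simp add: power_mult_distrib mult_2 power_add)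
  also have "(E * h) ^ m * h ^ m * h * S \<le> T ^ m * T ^ m * (T / 2) * S"
    using T2 TE h E S T by (intro mult_mono power_mono) auto
  also have "\<dots> = T ^ (2*m+1) * (S / 2)" by (simp add: mult_2 power_add)
  finally have 1: "J * T ^ (r*(m+1) - 1) \<le> T ^ (2*m+1) * (S / 2)" .
  have "r * (m+1) - 1 = (2*m+1) + (r-2)*(m+1)"
  proof -
    define q where "q = r - 2"
    have "r = q + 2" using r by (simp add: q_def)
    thus ?thesis by (simp add: algebra_simps)
  qed
  hence "T ^ (2*m+1) * (J * T ^ ((r-2)*(m+1))) \<le> T ^ (2*m+1) * (S / 2)" using 1 by (simp add: power_add mult_ac)
  hence "J * T ^ ((r-2)*(m+1)) \<le> S / 2" using T by simp
  moreover have "(1/2) * T ^ ((r-2)*(m+1)) \<le> J * T ^ ((r-2)*(m+1))" using J T by (intro mult_right_mono) auto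
  ultimately have ST: "T ^ ((r-2)*(m+1)) \<le> S" by linarith
  have b: "E ^ Suc (Suc m) * h * T ^ (r*(Suc (Suc m))+1) < J * S ^ (r - 1)"
  proof -
    have ET: "E \<le> T" using TE mult_left_mono[OF h, of E] E by linarith
    have "E ^ Suc (Suc m) * h = E ^ Suc m * (E * h)" by simp
    also have "\<dots> \<le> T ^ Suc m * T" using ET TE E h T by (intro mult_mono power_mono) auto
    finally have "E ^ Suc (Suc m) * h * T ^ (r*(Suc (Suc m))+1) \<le> (T ^ Suc m * T) * T ^ (r*(Suc (Suc m))+1)"
      using T by (intro mult_right_mono) auto
    also have "\<dots> = T ^ ((r+1)*(m+2)+1)" by (simp flip: power_add power_Suc2 add: algebra_simps)
    also have "\<dots> < (J * T) * T ^ ((r+1)*(m+2)+1)"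
    proof -
      have "2/3 * 2 \<le> J * T" using J T by (intro mult_mono) auto
      hence "1 * T ^ ((r+1)*(m+2)+1) < (J * T) * T ^ ((r+1)*(m+2)+1)" using T by (intro mult_strict_right_mono) auto
      thus ?thesis by simp
    qed
    also have "\<dots> = J * T ^ ((r+1)*(m+2)+2)" by simp
    also have "\<dots> \<le> J * T ^ ((r-2)*(m+1)*(r-1))"
    proof -
      have "(r+1)*(m+2)+2 \<le> (r-2)*(m+1)*(r-1)"
      proof -
        define k where "k = r - 6"
        have q: "r = k + 6" using r by (simp add: k_def)
        show ?thesis unfolding q by (simp add: algebra_simps)
      qed
      thus ?thesis using T J by (intro mult_left_mono power_increasing) auto
    qed
    also have "T ^ ((r-2)*(m+1)*(r-1)) = (T ^ ((r-2)*(m+1))) ^ (r-1)" by (rule power_mult)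
    also have "J * \<dots> \<le> J * S ^ (r - 1)"
      using ST T J by (intro mult_left_mono power_mono) auto
    finally show ?thesis .
  qed
  have b': "E ^ Suc m * h * T ^ (r*(Suc m)+1) < J * S ^ (r - 1)"
  proof -
    have "E ^ Suc m * h * T ^ (r*(Suc m)+1) \<le> E ^ Suc (Suc m) * h * T ^ (r*(Suc (Suc m))+1)"
      using E h T by (intro mult_mono power_increasing) auto
    thus ?thesis using b by linarith
  qed
  have "P (Suc m)" using PL m by simp
  moreover have "P (Suc (Suc m))" using \<open>P (Suc m)\<close> a_step[of "Suc m"] a_pos[of "Suc (Suc m)"] unfolding P_a by linarith
  ultimately show thesis using b b' by (intro that[of "Suc m"]) (auto simp: P_def)
qed

context reduced_diagonal_form
begin

lemma norm_s_ge: "cmod s \<ge> 3/2"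
proof -
  have "(3/2)\<^sup>2 \<le> (cmod s)\<^sup>2" using minus_D_ge unfolding norm_s_squared by (simp add: power2_eq_square)
  thus ?thesis by (rule power2_le_imp_le) simp
qed

lemma norm_j_ge: "cmod j \<ge> 2/3"
proof (rule ccontr)
  assume "\<not> cmod j \<ge> 2/3"
  hence j: "cmod j \<le> 2/3" by simp
  have "(3/2) ^ (r - 2) \<le> cmod s ^ (r - 2)" using norm_s_ge by (intro power_mono) auto
  also have "\<dots> \<le> (real r)\<^sup>2 * cmod j ^ r" by (rule norm_s_power_le)
  also have "\<dots> \<le> (real r)\<^sup>2 * (2/3) ^ r" using j by (intro mult_left_mono power_mono) auto
  finally have "(3/2) ^ (r - 2) * (3/2) ^ r \<le> (real r)\<^sup>2 * (2/3) ^ r * (3/2::real) ^ r" by (intro mult_right_mono) auto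
  also have "\<dots> = (real r)\<^sup>2 * ((2/3) * (3/2)) ^ r" by (simp only: power_mult_distrib mult.assoc)
  also have "\<dots> = (real r)\<^sup>2" by simp
  also have "\<dots> < (9/4) ^ (r - 1)" using degree by (rule square_less_power_9_4)
  also have "\<dots> = ((3/2)\<^sup>2) ^ (r - 1)" by (simp add: power2_eq_square)
  also have "\<dots> = (3/2) ^ (r - 2) * (3/2) ^ r"
  proof -
    have e: "2 * (r - 1) = (r - 2) + r" using degree by simp
    show ?thesis by (simp only: power_mult [symmetric] power_add [symmetric] e)
  qed
  finally show False by simp
qed

lemma norm_s_le: "cmod s \<le> real r * (max 1 (cmod j))\<^sup>2"
proof -
  define M where "M = max 1 (cmod j)"
  have M: "M \<ge> 1" "cmod j \<le> M" by (auto simp: M_def)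
  have "cmod s ^ (r - 2) \<le> (real r)\<^sup>2 * cmod j ^ r" by (rule norm_s_power_le)
  also have "\<dots> \<le> real r ^ (r - 2) * M ^ (2 * (r - 2))"
  proof (intro mult_mono)
    show "(real r)\<^sup>2 \<le> real r ^ (r - 2)" using degree by (intro power_increasing) auto
    have "cmod j ^ r \<le> M ^ r" using M by (intro power_mono) auto
    also have "\<dots> \<le> M ^ (2 * (r - 2))" using M degree by (intro power_increasing) auto
    finally show "cmod j ^ r \<le> M ^ (2 * (r - 2))" .
  qed auto
  also have "\<dots> = (real r * M\<^sup>2) ^ (r - 2)" by (simp add: power_mult_distrib power_mult)
  finally have "cmod s ^ (r - 2) \<le> (real r * M\<^sup>2) ^ (r - 2)" .
  moreover have "r - 2 > 0" using degree by simp
  ultimately show ?thesis unfolding M_def using power_mono_iff[of "cmod s" "real r * (max 1 (cmod j))\<^sup>2" "r - 2"] by simp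
qed

lemma Q_squared_ge: "3 * (- D) * y ^ 4 \<le> 16 * (Q x y)\<^sup>2"
proof -
  have le: "- D * y\<^sup>2 \<le> 4 * A * Q x y" unfolding Q_completed_square by simp
  have "0 \<le> - D * y\<^sup>2" using D_neg by (simp add: mult_nonpos_nonneg)
  with le have "(- D * y\<^sup>2)\<^sup>2 \<le> (4 * A * Q x y)\<^sup>2" by (intro power_mono) auto
  hence "D\<^sup>2 * y ^ 4 \<le> A\<^sup>2 * (16 * (Q x y)\<^sup>2)" by (simp add: power_mult_distrib flip: power_mult)
  hence "3 * (D\<^sup>2 * y ^ 4) \<le> 3 * (A\<^sup>2 * (16 * (Q x y)\<^sup>2))" by (rule mult_left_mono) simp
  also have "\<dots> = (3 * A\<^sup>2) * (16 * (Q x y)\<^sup>2)" by (simp only: mult.assoc)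
  also have "\<dots> \<le> - D * (16 * (Q x y)\<^sup>2)" by (intro mult_right_mono A_squared_le) auto
  finally have "(- D) * (3 * (- D) * y ^ 4) \<le> (- D) * (16 * (Q x y)\<^sup>2)" by (simp add: power2_eq_square)
  moreover have "- D > 0" using D_neg by simp
  ultimately show ?thesis by (simp only: mult_le_cancel_left_pos)
qed

text \<open>
  Here \<open>Q\<close> being reduced enters: \<open>3 A\<^sup>2 \<le> |D|\<close> gives \<open>Q(x, y) \<ge> (sqrt 3 / 4) sqrt |D| y\<^sup>2\<close>, and
  \<open>2 / 5\<close> is a rational lower bound for \<open>sqrt 3 / 4\<close>.
\<close>

lemma norm_u_ge:
  assumes "coprime x y"
  shows "2/5 * cmod j * (of_int y)\<^sup>2 \<le> (cmod (u x y))\<^sup>2"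
proof -
  have "of_int (3 * (- D) * y ^ 4) \<le> (of_int (16 * (Q x y)\<^sup>2) :: real)" using Q_squared_ge of_int_le_iff by blast
  hence "3 * (- of_int D) * of_int y ^ 4 \<le> 16 * (of_int (Q x y) :: real)\<^sup>2" by simp
  hence le: "(3/16) * ((cmod s)\<^sup>2 * of_int y ^ 4) \<le> (of_int (Q x y))\<^sup>2" unfolding norm_s_squared by simp
  have "(2/5 * cmod j * (of_int y)\<^sup>2)\<^sup>2 = (cmod \<kappa>)\<^sup>2 * ((4/25) * ((cmod s)\<^sup>2 * of_int y ^ 4))"
    by (simp add: norm_j power_mult_distrib power_divide flip: power_mult)
  also have "\<dots> \<le> (cmod \<kappa>)\<^sup>2 * ((3/16) * ((cmod s)\<^sup>2 * of_int y ^ 4))"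
    by (intro mult_left_mono mult_right_mono) auto
  also have "\<dots> \<le> (cmod \<kappa>)\<^sup>2 * (of_int (Q x y))\<^sup>2" by (intro mult_left_mono le) auto
  also have "\<dots> = ((cmod (u x y))\<^sup>2)\<^sup>2" unfolding norm_u_squared[OF assms] by (simp add: power_mult_distrib)
  finally show ?thesis by (rule power2_le_imp_le) simp
qed

text \<open>
  A small value of the form makes \<open>v / u\<close> close to \<open>1\<close>, provided that \<open>1\<close> is a nearest \<open>r\<close>-th root of
  unity: then \<open>r \<phi>\<close> is the argument of \<open>(v / u) ^ r\<close> in \<open>{-pi..pi}\<close>, and \<open>F = u ^ r (1 - cis (r \<phi>))\<close>.
\<close>

lemma phase_le:
  assumes "coprime x y" "v x y = u x y * cis \<phi>" "\<bar>\<phi>\<bar> \<le> pi / real r" "\<bar>form_eval r F x y\<bar> \<le> int h"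
  shows "real r * \<bar>\<phi>\<bar> * cmod (u x y) ^ r \<le> 2 * real h"
proof -
  have "u x y ^ r * (1 - cis (real r * \<phi>)) = of_int (form_eval r F x y)"
    by (simp add: form_eq assms(2) power_mult_distrib Complex.DeMoivre algebra_simps)
  hence "cmod (u x y) ^ r * cmod (1 - cis (real r * \<phi>)) = \<bar>of_int (form_eval r F x y)\<bar>"
    by (metis norm_mult norm_of_int norm_power)
  also have "\<dots> \<le> real h" using assms(4) by (metis of_int_abs of_int_le_iff of_int_of_nat_eq)
  finally have 1: "cmod (u x y) ^ r * cmod (1 - cis (real r * \<phi>)) \<le> real h" .
  have "\<bar>real r * \<phi>\<bar> \<le> pi" using assms(3) degree by (simp add: abs_mult field_simps)
  from abs_le_norm_cis_minus_one[OF this] have "real r * \<bar>\<phi>\<bar> \<le> 2 * cmod (1 - cis (real r * \<phi>))"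
    by (simp add: abs_mult)
  hence "real r * \<bar>\<phi>\<bar> * cmod (u x y) ^ r \<le> 2 * cmod (1 - cis (real r * \<phi>)) * cmod (u x y) ^ r"
    by (intro mult_right_mono) auto
  also have "\<dots> \<le> 2 * real h" using 1 by (simp add: mult_ac)
  finally show ?thesis .
qed

text \<open>
  The auxiliary number of the method: it compares the fraction \<open>v / u\<close> at the second solution with the
  Pade approximant evaluated at the first one.
\<close>

definition pade_cross where
  "pade_cross n x0 y0 x1 y1 = pade (1 / real r) n (u x0 y0 ^ r) (v x0 y0 ^ r) * (u x0 y0 * v x1 y1) -
     pade (1 / real r) n (v x0 y0 ^ r) (u x0 y0 ^ r) * (v x0 y0 * u x1 y1)"

text \<open>
  After multiplication by \<open>r ^ (2 n) (r s) ^ n / \<kappa>\<close> the auxiliary number has the shape \<open>\<rho> - cnj \<rho>\<close> with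
  \<open>\<rho>\<close> in the quadratic order, because complex conjugation exchanges the two arguments of the approximant
  and the two cross products. If it is not zero, it is therefore at least \<open>|s|\<close> in absolute value.
\<close>

lemma pade_cross_lower_bound:
  assumes "coprime x0 y0" "pade_cross n x0 y0 x1 y1 \<noteq> 0"
  shows "cmod j \<le> (real r ^ 3 * cmod s) ^ n * cmod (pade_cross n x0 y0 x1 y1)"
proof -
  define p where "p X Y = of_nat r ^ (2*n) * pade (1 / real r) n X Y" for X Y
  define U V where "U = u x0 y0 ^ r" and "V = v x0 y0 ^ r"
  define Z where "Z = of_nat r * s * U"
  have Z: "Z \<in> quad_ring" using resolvent(1)[OF assms(1)] by (simp add: Z_def U_def)
  have cnjU: "cnj U = - V" using resolvent(2)[OF assms(1)] by (simp add: U_def V_def)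
  have cnjZ: "cnj Z = of_nat r * s * V" by (simp add: Z_def cnj_s cnjU)
  have p_ring: "p X Y \<in> quad_ring" if "X \<in> quad_ring" "Y \<in> quad_ring" for X Y
  proof -
    have "p X Y = (\<Sum>l\<le>n. of_real (real r ^ (2*n) * pade_coeff (1 / real r) n l) * (X ^ l * Y ^ (n-l)))"
      by (simp add: p_def pade_def sum_distrib_left mult_ac)
    also have "\<dots> \<in> quad_ring"
    proof (intro quad_ring_sum quad_ring_mult quad_ring_power that)
      fix l assume "l \<in> {..n}"
      hence "real r ^ (2*n) * pade_coeff (1 / real r) n l \<in> \<int>"
        using degree by (intro pade_coeff_integral) auto
      then obtain k :: int where "real r ^ (2*n) * pade_coeff (1 / real r) n l = of_int k" by (elim Ints_cases)
      thus "of_real (real r ^ (2*n) * pade_coeff (1 / real r) n l) \<in> quad_ring"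
        by (simp only: of_real_of_int_eq of_int_quad_ring)
    qed
    finally show ?thesis .
  qed
  have p_cnj: "cnj (p X Y) = p (cnj X) (cnj Y)" for X Y
    by (simp add: p_def pade_def)
  have p_hom: "p (of_nat r * s * X) (of_nat r * s * Y) = (of_nat r * s) ^ n * p X Y" for X Y
    by (simp add: p_def pade_homogeneous)
  define t where "t = of_int (A * x0 * x1 + C * y0 * y1) + of_int (x0 * y1) * \<sigma> + of_int (y0 * x1) * cnj \<sigma>"
  have "\<sigma> \<in> quad_ring" using quad_ringI[of 0 1] by simp
  hence t: "t \<in> quad_ring" unfolding t_def
    by (intro quad_ring_add quad_ring_mult of_int_quad_ring quad_ring_cnj)
  have \<alpha>\<delta>: "\<alpha> * \<delta> = \<kappa> * \<sigma>" and \<beta>\<gamma>: "\<beta> * \<gamma> = \<kappa> * cnj \<sigma>"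
  proof -
    have "2 * (\<alpha> * \<delta>) = (\<alpha> * \<delta> + \<beta> * \<gamma>) + j" "2 * (\<beta> * \<gamma>) = (\<alpha> * \<delta> + \<beta> * \<gamma>) - j" by (simp_all add: j_def)
    hence "2 * (\<alpha> * \<delta>) = 2 * (\<kappa> * \<sigma>)" "2 * (\<beta> * \<gamma>) = 2 * (\<kappa> * cnj \<sigma>)"
      unfolding coefficients(2) j_eq by (simp_all add: \<sigma>_def cnj_s distrib_left right_diff_distrib)
    thus "\<alpha> * \<delta> = \<kappa> * \<sigma>" "\<beta> * \<gamma> = \<kappa> * cnj \<sigma>" by simp_all
  qed
  have uv: "u x0 y0 * v x1 y1 = \<kappa> * t" "v x0 y0 * u x1 y1 = \<kappa> * cnj t"
  proof -
    have "u x0 y0 * v x1 y1 = (\<alpha> * \<gamma>) * of_int (x0 * x1) + (\<alpha> * \<delta>) * of_int (x0 * y1) +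
        (\<beta> * \<gamma>) * of_int (y0 * x1) + (\<beta> * \<delta>) * of_int (y0 * y1)"
      by (simp add: u_def v_def algebra_simps)
    thus "u x0 y0 * v x1 y1 = \<kappa> * t" unfolding coefficients \<alpha>\<delta> \<beta>\<gamma> t_def by (simp add: algebra_simps)
    have "v x0 y0 * u x1 y1 = (\<alpha> * \<gamma>) * of_int (x0 * x1) + (\<beta> * \<gamma>) * of_int (x0 * y1) +
        (\<alpha> * \<delta>) * of_int (y0 * x1) + (\<beta> * \<delta>) * of_int (y0 * y1)"
      by (simp add: u_def v_def algebra_simps)
    thus "v x0 y0 * u x1 y1 = \<kappa> * cnj t" unfolding coefficients \<alpha>\<delta> \<beta>\<gamma> t_def by (simp add: algebra_simps)
  qed
  define \<rho> where "\<rho> = p Z (cnj Z) * t"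
  have "\<rho> \<in> quad_ring" unfolding \<rho>_def by (intro quad_ring_mult p_ring Z t quad_ring_cnj)
  then obtain b where b: "\<rho> - cnj \<rho> = of_int b * s" by (rule quad_ring_minus_cnj)
  have "\<kappa> * (\<rho> - cnj \<rho>) = of_nat r ^ (2*n) * (of_nat r * s) ^ n * pade_cross n x0 y0 x1 y1"
  proof -
    have "\<kappa> * (\<rho> - cnj \<rho>) = p Z (cnj Z) * (\<kappa> * t) - p (cnj Z) Z * (\<kappa> * cnj t)"
      by (simp add: \<rho>_def p_cnj algebra_simps)
    also have "p Z (cnj Z) = (of_nat r * s) ^ n * p U V" unfolding cnjZ unfolding Z_def by (rule p_hom)
    also have "p (cnj Z) Z = (of_nat r * s) ^ n * p V U" unfolding cnjZ unfolding Z_def by (rule p_hom)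
    finally show ?thesis unfolding pade_cross_def uv p_def U_def V_def by (simp add: algebra_simps)
  qed
  hence eq: "\<kappa> * (of_int b * s) = of_nat r ^ (2*n) * (of_nat r * s) ^ n * pade_cross n x0 y0 x1 y1" unfolding b .
  have "b \<noteq> 0"
  proof
    assume "b = 0"
    with eq show False using assms(2) s_nonzero degree by simp
  qed
  hence "cmod j \<le> cmod j * \<bar>of_int b\<bar>" by (intro mult_right_mono[of 1, simplified] mult_le_cancel_left1[THEN iffD2]) auto
  also have "\<dots> = cmod (\<kappa> * (of_int b * s))" by (simp add: norm_j norm_mult)
  also have "\<dots> = (real r ^ 3 * cmod s) ^ n * cmod (pade_cross n x0 y0 x1 y1)"
    unfolding eq by (simp add: norm_mult norm_power power_mult_distrib power_mult power3_eq_cube power2_eq_square mult_ac)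
  finally show ?thesis .
qed

lemma pade_cross_nonzero:
  assumes "coprime x0 y0" "coprime x1 y1" "form_eval r F x0 y0 \<noteq> 0"
  shows "pade_cross n x0 y0 x1 y1 \<noteq> 0 \<or> pade_cross (Suc n) x0 y0 x1 y1 \<noteq> 0"
proof (rule ccontr)
  assume "\<not> ?thesis"
  hence z: "pade_cross n x0 y0 x1 y1 = 0" "pade_cross (Suc n) x0 y0 x1 y1 = 0" by simp_all
  define U V where "U = u x0 y0 ^ r" and "V = v x0 y0 ^ r"
  define a b where "a = u x0 y0 * v x1 y1" and "b = v x0 y0 * u x1 y1"
  have nz: "u x0 y0 \<noteq> 0" "v x0 y0 \<noteq> 0" "u x1 y1 \<noteq> 0" "v x1 y1 \<noteq> 0"
    using u_times_v[of x0 y0] u_times_v[of x1 y1] \<kappa>_nonzero Q_pos_coprime[OF assms(1)] Q_pos_coprime[OF assms(2)]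
    by auto
  hence ab: "a \<noteq> 0" "b \<noteq> 0" by (simp_all add: a_def b_def)
  have "U \<noteq> V" using form_eq[of x0 y0] assms(3) by (auto simp: U_def V_def)
  moreover have "U \<noteq> 0" using nz by (simp add: U_def)
  ultimately have ne: "pade (1 / real r) n U V * pade (1 / real r) (Suc n) V U \<noteq> pade (1 / real r) (Suc n) U V * pade (1 / real r) n V U"
    using degree by (intro pade_cross_products_distinct) auto
  have e: "pade (1 / real r) n U V * a = pade (1 / real r) n V U * b"
      "pade (1 / real r) (Suc n) U V * a = pade (1 / real r) (Suc n) V U * b"
    using z by (simp_all add: pade_cross_def U_def V_def a_def b_def)
  have "(pade (1 / real r) n U V * pade (1 / real r) (Suc n) V U) * (a * b) =
        (pade (1 / real r) n U V * a) * (pade (1 / real r) (Suc n) V U * b)" by (simp add: mult_ac)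
  also have "\<dots> = (pade (1 / real r) (Suc n) U V * pade (1 / real r) n V U) * (a * b)"
    unfolding e(1) unfolding e(2)[symmetric] by (simp add: mult_ac)
  finally show False using ne ab by simp
qed

text \<open>
  The first term of the bound comes from the remainder of the approximation at the first solution, the
  second from the distance of \<open>v / u\<close> to \<open>1\<close> at the second solution.
\<close>

lemma pade_cross_upper_bound:
  assumes c: "coprime x0 y0" "coprime x1 y1"
    and v: "v x0 y0 = u x0 y0 * cis \<phi>0" "v x1 y1 = u x1 y1 * cis \<phi>1"
  shows "cmod (pade_cross n x0 y0 x1 y1) \<le> cmod (u x0 y0) ^ (r*n+1) * cmod (u x1 y1) *
      ((real r * \<bar>\<phi>0\<bar>) ^ (2*n+1) / real r + 4 ^ n * \<bar>\<phi>1\<bar>)"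
proof -
  define u0 v0 u1 v1 where "u0 = u x0 y0" and "v0 = v x0 y0" and "u1 = u x1 y1" and "v1 = v x1 y1"
  define P P' where "P = pade (1 / real r) n (u0 ^ r) (v0 ^ r)" and "P' = pade (1 / real r) n (v0 ^ r) (u0 ^ r)"
  have n0: "cmod v0 = cmod u0" and n1: "cmod v1 = cmod u1" using norm_v c by (simp_all add: u0_def v0_def u1_def v1_def)
  have "pade_cross n x0 y0 x1 y1 = (u0 * P - v0 * P') * v1 + P' * v0 * (v1 - u1)"
    by (simp add: pade_cross_def u0_def v0_def u1_def v1_def P_def P'_def algebra_simps)
  also have "cmod \<dots> \<le> cmod (u0 * P - v0 * P') * cmod v1 + cmod P' * cmod v0 * cmod (v1 - u1)"
    by (simp only: norm_mult[symmetric] norm_triangle_ineq)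
  also have "\<dots> \<le> (cmod u0 ^ (r*n+1) * (1 / real r * (real r * \<bar>\<phi>0\<bar>) ^ (2*n+1))) * cmod u1 +
      (4 ^ n * cmod u0 ^ (r*n)) * cmod u0 * (cmod u1 * \<bar>\<phi>1\<bar>)"
  proof (intro add_mono mult_mono)
    show "cmod (u0 * P - v0 * P') \<le> cmod u0 ^ (r*n+1) * (1 / real r * (real r * \<bar>\<phi>0\<bar>) ^ (2*n+1))"
      unfolding P_def P'_def using degree v(1) by (intro pade_approximation) (auto simp: u0_def v0_def)
    show "cmod P' \<le> 4 ^ n * cmod u0 ^ (r*n)"
      using norm_pade_le[of "1 / real r" "v0 ^ r" "cmod u0 ^ r" "u0 ^ r" n] degree
      by (simp add: P'_def norm_power n0 power_mult)
    have "v1 - u1 = - (u1 * (1 - cis \<phi>1))" using v(2) by (simp add: u1_def v1_def algebra_simps)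
    thus "cmod (v1 - u1) \<le> cmod u1 * \<bar>\<phi>1\<bar>"
      using norm_cis_minus_one_le[of \<phi>1] by (simp add: norm_mult mult_left_mono)
  qed (auto simp: n0 n1)
  also have "\<dots> = cmod u0 ^ (r*n+1) * cmod u1 * ((real r * \<bar>\<phi>0\<bar>) ^ (2*n+1) / real r + 4 ^ n * \<bar>\<phi>1\<bar>)"
    by (simp add: algebra_simps)
  finally show ?thesis by (simp add: u0_def u1_def)
qed

text \<open>
  The determinant \<open>u\<^sub>0 v\<^sub>1 - u\<^sub>1 v\<^sub>0\<close> is \<open>j\<close> times a nonzero integer, while both \<open>v\<^sub>i\<close> are close to \<open>u\<^sub>i\<close>.
\<close>

lemma gap_principle:
  assumes c: "coprime x0 y0" "coprime x1 y1" and ind: "x0 * y1 \<noteq> x1 * y0"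
    and h: "\<bar>form_eval r F x0 y0\<bar> \<le> int h" "\<bar>form_eval r F x1 y1\<bar> \<le> int h"
    and v: "v x0 y0 = u x0 y0 * cis \<phi>0" "v x1 y1 = u x1 y1 * cis \<phi>1"
    and \<phi>: "\<bar>\<phi>0\<bar> \<le> pi / real r" "\<bar>\<phi>1\<bar> \<le> pi / real r"
    and le: "cmod (u x0 y0) \<le> cmod (u x1 y1)"
  shows "real r * cmod j * cmod (u x0 y0) ^ (r - 1) \<le> 4 * (real h * cmod (u x1 y1))"
proof -
  define T S where "T = cmod (u x0 y0)" and "S = cmod (u x1 y1)"
  have T: "T > 0" using u_times_v[of x0 y0] \<kappa>_nonzero Q_pos_coprime[OF c(1)] by (auto simp: T_def)
  have "cmod j * 1 \<le> cmod j * \<bar>of_int (x0 * y1 - x1 * y0)\<bar>"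
    using ind by (intro mult_left_mono) (auto simp del: of_int_diff of_int_mult simp flip: of_int_abs)
  also have "\<dots> = cmod (u x0 y0 * v x1 y1 - u x1 y1 * v x0 y0)"
  proof -
    have "u x0 y0 * v x1 y1 - u x1 y1 * v x0 y0 = j * of_int (x0 * y1 - x1 * y0)"
      by (simp add: u_def v_def j_def algebra_simps)
    thus ?thesis by (simp only: norm_mult norm_of_int)
  qed
  also have "u x0 y0 * v x1 y1 - u x1 y1 * v x0 y0 = u x0 y0 * u x1 y1 * ((1 - cis \<phi>0) - (1 - cis \<phi>1))"
    by (simp add: v algebra_simps)
  also have "cmod \<dots> \<le> T * S * (\<bar>\<phi>0\<bar> + \<bar>\<phi>1\<bar>)"
  proof -
    have "cmod ((1 - cis \<phi>0) - (1 - cis \<phi>1)) \<le> \<bar>\<phi>0\<bar> + \<bar>\<phi>1\<bar>"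
      using norm_triangle_ineq4[of "1 - cis \<phi>0" "1 - cis \<phi>1"] norm_cis_minus_one_le[of \<phi>0] norm_cis_minus_one_le[of \<phi>1]
      by linarith
    thus ?thesis unfolding norm_mult S_def T_def by (intro mult_left_mono) auto
  qed
  finally have 1: "cmod j \<le> T * S * (\<bar>\<phi>0\<bar> + \<bar>\<phi>1\<bar>)" by simp
  have "real r * \<bar>\<phi>1\<bar> * T ^ r \<le> real r * \<bar>\<phi>1\<bar> * S ^ r"
    using le T by (intro mult_left_mono power_mono) (auto simp: T_def S_def)
  also have "\<dots> \<le> 2 * real h" unfolding S_def by (rule phase_le[OF c(2) v(2) \<phi>(2) h(2)])
  finally have "real r * \<bar>\<phi>1\<bar> * T ^ r \<le> 2 * real h" .
  moreover have "real r * \<bar>\<phi>0\<bar> * T ^ r \<le> 2 * real h"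
    unfolding T_def by (rule phase_le[OF c(1) v(1) \<phi>(1) h(1)])
  ultimately have 2: "real r * (\<bar>\<phi>0\<bar> + \<bar>\<phi>1\<bar>) * T ^ r \<le> 4 * real h" by (simp add: algebra_simps)
  have "real r * (cmod j * T ^ r) \<le> real r * ((T * S * (\<bar>\<phi>0\<bar> + \<bar>\<phi>1\<bar>)) * T ^ r)" using 1 T by (intro mult_left_mono mult_right_mono) auto
  also have "\<dots> = T * S * (real r * (\<bar>\<phi>0\<bar> + \<bar>\<phi>1\<bar>) * T ^ r)" by (simp add: mult_ac)
  also have "\<dots> \<le> T * S * (4 * real h)" using 2 T by (intro mult_left_mono) (auto simp: S_def)
  finally have "real r * (cmod j * T ^ r) \<le> 4 * (T * (real h * S))" by (simp add: mult_ac)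
  moreover have "T ^ r = T * T ^ (r - 1)" using degree by (simp flip: power_Suc)
  ultimately have "T * (real r * cmod j * T ^ (r - 1)) \<le> T * (4 * (real h * S))" by (simp add: mult_ac)
  thus ?thesis using T unfolding S_def T_def by simp
qed

text \<open>
  For the order provided by \<open>approximation_order_exists\<close> one of the two auxiliary numbers is nonzero, and
  its upper and lower bounds contradict each other.
\<close>

lemma no_two_large_solutions:
  assumes c: "coprime x0 y0" "coprime x1 y1" and ind: "x0 * y1 \<noteq> x1 * y0" and F0: "form_eval r F x0 y0 \<noteq> 0"
    and h: "\<bar>form_eval r F x0 y0\<bar> \<le> int h" "\<bar>form_eval r F x1 y1\<bar> \<le> int h" "h \<ge> 1"
    and v: "v x0 y0 = u x0 y0 * cis \<phi>0" "v x1 y1 = u x1 y1 * cis \<phi>1"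
    and \<phi>: "\<bar>\<phi>0\<bar> \<le> pi / real r" "\<bar>\<phi>1\<bar> \<le> pi / real r"
    and le: "cmod (u x0 y0) \<le> cmod (u x1 y1)"
    and large: "2 * real h \<le> cmod (u x0 y0)" "4 * real r ^ 3 * cmod s * real h \<le> cmod (u x0 y0)"
  shows False
proof -
  define T S where "T = cmod (u x0 y0)" and "S = cmod (u x1 y1)"
  \<comment> \<open>One step of the order costs at most this factor: the denominator \<open>r ^ 3 |s|\<close>, and \<open>4\<close>, which bounds the growth of the approximants as well as the square of the constant \<open>2\<close> in \<open>phase_le\<close>.\<close>
  define E where "E = 4 * real r ^ 3 * cmod s"
  have T: "T > 0" using large(1) h(3) unfolding T_def[symmetric] by linarith
  have S: "S > 0" using T le unfolding S_def T_def by (rule order_less_le_trans)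
  have E: "E \<ge> 1"
  proof -
    have "1 \<le> real r ^ 3" using degree by (intro one_le_power) auto
    hence "1 * (3/2) \<le> real r ^ 3 * cmod s" using norm_s_ge by (intro mult_mono) auto
    thus ?thesis by (simp add: E_def)
  qed
  have gap: "cmod j * T ^ (r - 1) \<le> real h * S"
  proof -
    have "4 * (cmod j * T ^ (r - 1)) \<le> real r * (cmod j * T ^ (r - 1))"
      using degree T by (intro mult_right_mono) auto
    also have "\<dots> \<le> 4 * (real h * S)"
      using gap_principle[OF c ind h(1,2) v \<phi> le] unfolding S_def T_def by (simp only: mult.assoc)
    finally show ?thesis by simp
  qed
  obtain n where n1: "\<And>k. k \<in> {n, Suc n} \<Longrightarrow> E ^ k * real h ^ (2*k+1) * S < cmod j * T ^ (r*(k+1) - 1)"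
    and n2: "\<And>k. k \<in> {n, Suc n} \<Longrightarrow> E ^ k * real h * T ^ (r*k+1) < cmod j * S ^ (r - 1)"
    using approximation_order_exists[OF degree _ _ E _ norm_j_ge S gap] h(3) large unfolding E_def T_def by auto
  obtain k where k: "k \<in> {n, Suc n}" "pade_cross k x0 y0 x1 y1 \<noteq> 0"
    using pade_cross_nonzero[OF c F0, of n] by auto
  have r0: "real r > 0" using degree by simp
  have \<phi>0: "real r * \<bar>\<phi>0\<bar> \<le> 2 * real h / T ^ r"
    using phase_le[OF c(1) v(1) \<phi>(1) h(1)] T by (simp add: T_def field_simps)
  have \<phi>1: "\<bar>\<phi>1\<bar> \<le> 2 * real h / (real r * S ^ r)"
    using phase_le[OF c(2) v(2) \<phi>(2) h(2)] S r0 by (simp add: S_def field_simps)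
  have "cmod j \<le> (real r ^ 3 * cmod s) ^ k * cmod (pade_cross k x0 y0 x1 y1)" by (rule pade_cross_lower_bound[OF c(1) k(2)])
  also have "\<dots> \<le> (real r ^ 3 * cmod s) ^ k * (T ^ (r*k+1) * S *
      ((real r * \<bar>\<phi>0\<bar>) ^ (2*k+1) / real r + 4 ^ k * \<bar>\<phi>1\<bar>))"
    unfolding S_def T_def by (intro mult_left_mono pade_cross_upper_bound c v) auto
  also have "\<dots> \<le> (real r ^ 3 * cmod s) ^ k * (T ^ (r*k+1) * S *
      ((2 * real h / T ^ r) ^ (2*k+1) / real r + 4 ^ k * (2 * real h / (real r * S ^ r))))"
    using \<phi>0 \<phi>1 S T by (intro mult_left_mono add_mono divide_right_mono power_mono) auto
  also have "\<dots> = 2 / real r * (E ^ k * real h ^ (2*k+1) * S / T ^ (r*(k+1) - 1) + E ^ k * real h * T ^ (r*k+1) / S ^ (r - 1))"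
  proof -
    have Ek: "E ^ k = 4 ^ k * (real r ^ 3 * cmod s) ^ k" by (simp add: E_def power_mult_distrib mult.assoc)
    have two: "(2::real) ^ (2*k+1) = 4 ^ k * 2" by (simp add: power_mult)
    have Tp: "T ^ (r*k+1) * T ^ (r*(k+1) - 1) = (T ^ r) ^ (2*k+1)"
    proof -
      have e: "(r*k+1) + (r*(k+1) - 1) = r*(2*k+1)" using degree by (simp add: algebra_simps)
      show ?thesis by (simp only: power_mult [symmetric] power_add [symmetric] e)
    qed
    hence Tp': "T ^ (r*k+1) / (T ^ r) ^ (2*k+1) = 1 / T ^ (r*(k+1) - 1)" using T by (simp add: field_simps)
    have Sp: "S / S ^ r = 1 / S ^ (r - 1)"
    proof -
      have "S ^ r = S * S ^ (r - 1)" using degree by (simp flip: power_Suc)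
      thus ?thesis using S by simp
    qed
    define R where "R = (real r ^ 3 * cmod s) ^ k"
    have "R * (T ^ (r*k+1) * S * ((2 * real h / T ^ r) ^ (2*k+1) / real r + 4 ^ k * (2 * real h / (real r * S ^ r)))) =
       R * S * (4 ^ k * 2) * real h ^ (2*k+1) / real r * (T ^ (r*k+1) / (T ^ r) ^ (2*k+1)) +
       R * T ^ (r*k+1) * 4 ^ k * 2 * real h / real r * (S / S ^ r)"
      by (simp only: power_divide power_mult_distrib two) (simp add: field_simps)
    also have "\<dots> = 2 / real r * (4 ^ k * R * real h ^ (2*k+1) * S / T ^ (r*(k+1) - 1) + 4 ^ k * R * real h * T ^ (r*k+1) / S ^ (r - 1))"
      unfolding Tp' Sp by (simp add: algebra_simps)
    finally show ?thesis unfolding Ek R_def .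
  qed
  also have "\<dots> < 2 / real r * (cmod j + cmod j)"
    using n1[OF k(1)] n2[OF k(1)] T S r0 by (intro mult_strict_left_mono add_strict_mono) (auto simp: field_simps)
  also have "\<dots> = 4 * cmod j / real r" by simp
  also have "\<dots> \<le> 4 * cmod j / 6" using degree by (intro divide_left_mono) auto
  also have "\<dots> \<le> cmod j" by simp
  finally show False by simp
qed

end

section \<open>Counting solutions\<close>

lemma primitive_pairs_independent:
  fixes x0 y0 x1 y1 :: int
  assumes "coprime x0 y0" "coprime x1 y1" "y0 > 0" "y1 > 0" "(x0, y0) \<noteq> (x1, y1)"
  shows "x0 * y1 \<noteq> x1 * y0"
proof
  assume eq: "x0 * y1 = x1 * y0"
  have "y0 dvd x0 * y1" "y1 dvd x1 * y0" by (simp add: eq) (simp flip: eq)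
  hence "y0 dvd y1" "y1 dvd y0"
    using assms(1,2) by (simp_all add: coprime_dvd_mult_right_iff coprime_commute)
  hence "y0 = y1" using assms(3,4) by (simp add: zdvd_antisym_nonneg)
  moreover from this have "x0 = x1" using eq assms(3) by simp
  ultimately show False using assms(5) by simp
qed

context reduced_diagonal_form
begin

text \<open>
  The solutions for which \<open>1\<close> is a nearest \<open>r\<close>-th root of unity to \<open>v / u\<close>. The condition \<open>y > 0\<close> selects
  one of \<open>(x, y)\<close> and \<open>(-x, -y)\<close>.
\<close>

definition aligned_solutions :: "nat \<Rightarrow> real \<Rightarrow> (int \<times> int) set" where
  "aligned_solutions h Y = {(x, y). coprime x y \<and> y > 0 \<and> Y \<le> of_int y \<and>
     form_eval r F x y \<noteq> 0 \<and> \<bar>form_eval r F x y\<bar> \<le> int h \<and>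
     (\<exists>\<phi>. \<bar>\<phi>\<bar> \<le> pi / real r \<and> v x y = u x y * cis \<phi>)}"

lemma aligned_gap:
  assumes "(x0, y0) \<in> aligned_solutions h Y" "(x1, y1) \<in> aligned_solutions h Y" "(x0, y0) \<noteq> (x1, y1)"
    and "cmod (u x0 y0) \<le> cmod (u x1 y1)"
  shows "cmod (u x0 y0) ^ (r - 1) \<le> real h * cmod (u x1 y1)"
proof -
  from assms(1) obtain \<phi>0 where 0: "coprime x0 y0" "y0 > 0" "form_eval r F x0 y0 \<noteq> 0"
    "\<bar>form_eval r F x0 y0\<bar> \<le> int h" "\<bar>\<phi>0\<bar> \<le> pi / real r" "v x0 y0 = u x0 y0 * cis \<phi>0"
    by (auto simp: aligned_solutions_def)
  from assms(2) obtain \<phi>1 where 1: "coprime x1 y1" "y1 > 0" "form_eval r F x1 y1 \<noteq> 0"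
    "\<bar>form_eval r F x1 y1\<bar> \<le> int h" "\<bar>\<phi>1\<bar> \<le> pi / real r" "v x1 y1 = u x1 y1 * cis \<phi>1"
    by (auto simp: aligned_solutions_def)
  have "x0 * y1 \<noteq> x1 * y0" using 0 1 assms(3) by (intro primitive_pairs_independent) auto
  from gap_principle[OF 0(1) 1(1) this 0(4) 1(4) 0(6) 1(6) 0(5) 1(5) assms(4)]
  have gap: "real r * cmod j * cmod (u x0 y0) ^ (r - 1) \<le> 4 * (real h * cmod (u x1 y1))" .
  have "6 * (2/3) \<le> real r * cmod j" using norm_j_ge degree by (intro mult_mono) auto
  hence "4 * cmod (u x0 y0) ^ (r - 1) \<le> real r * cmod j * cmod (u x0 y0) ^ (r - 1)"
    by (intro mult_right_mono) auto
  with gap show ?thesis by linarith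
qed

text \<open>
  Iteration of the gap principle. The exponent \<open>1 / (r - 2)\<close> is the fixed point of
  \<open>e \<mapsto> (r - 1) e - 1\<close>, the effect of one step on the exponent of \<open>h\<close>, and the excess \<open>\<epsilon>\<close> is multiplied
  by \<open>r - 1\<close> at each step.
\<close>

lemma aligned_growth:
  fixes c \<epsilon> :: real and X :: "(int \<times> int) set"
  assumes h: "h \<ge> 1" and c: "c \<ge> 1"
    and start: "\<And>x y. (x, y) \<in> aligned_solutions h Y \<Longrightarrow> c * real h powr (1 / (real r - 2) + \<epsilon>) \<le> cmod (u x y)"
    and X: "finite X" "X \<subseteq> aligned_solutions h Y" "card X = Suc k"
  shows "\<exists>x y. (x, y) \<in> X \<and> (\<forall>(x', y') \<in> X. cmod (u x' y') \<le> cmod (u x y)) \<and>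
     c ^ ((r - 1) ^ k) * real h powr (1 / (real r - 2) + \<epsilon> * (real r - 1) ^ k) \<le> cmod (u x y)"
  using X
proof (induction k arbitrary: X)
  case 0
  then obtain p where "X = {p}" by (auto simp: card_1_singleton_iff)
  moreover obtain x y where "p = (x, y)" by (cases p)
  ultimately have "X = {(x, y)}" by simp
  thus ?case using 0 start[of x y] by auto
next
  case (Suc k)
  define T where "T p = cmod (u (fst p) (snd p))" for p
  have "X \<noteq> {}" using Suc.prems by auto
  obtain p where p: "p \<in> X" "\<forall>q \<in> X. T q \<le> T p"
  proof -
    have "Max (T ` X) \<in> T ` X" using Suc.prems \<open>X \<noteq> {}\<close> by (intro Max_in) auto
    then obtain p where "p \<in> X" "T p = Max (T ` X)" by auto
    thus thesis using Suc.prems by (intro that[of p]) auto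
  qed
  have "finite (X - {p})" "X - {p} \<subseteq> aligned_solutions h Y" "card (X - {p}) = Suc k"
    using Suc.prems p by auto
  from Suc.IH[OF this] obtain x0 y0 where p0: "(x0, y0) \<in> X - {p}"
    and le0: "c ^ ((r - 1) ^ k) * real h powr (1 / (real r - 2) + \<epsilon> * (real r - 1) ^ k) \<le> cmod (u x0 y0)"
    by blast
  obtain x y where xy: "p = (x, y)" by (cases p)
  have le: "cmod (u x0 y0) \<le> cmod (u x y)" using p p0 by (auto simp: T_def xy)
  have "(x0, y0) \<in> aligned_solutions h Y" "(x, y) \<in> aligned_solutions h Y" "(x0, y0) \<noteq> (x, y)"
    using p p0 Suc.prems(2) unfolding xy by auto
  from aligned_gap[OF this le] have gap: "cmod (u x0 y0) ^ (r - 1) \<le> real h * cmod (u x y)" .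
  define e where "e = 1 / (real r - 2) + \<epsilon> * (real r - 1) ^ k"
  have r: "real r - 2 > 0" "real (r - 1) = real r - 1" using degree by auto
  have e: "e * (real r - 1) = (1 / (real r - 2) + \<epsilon> * (real r - 1) ^ Suc k) + 1"
    using r by (simp add: e_def field_simps)
  have "real h * (c ^ ((r - 1) ^ Suc k) * real h powr (1 / (real r - 2) + \<epsilon> * (real r - 1) ^ Suc k)) =
      c ^ ((r - 1) ^ Suc k) * real h powr (e * (real r - 1))"
    unfolding e powr_add using h by simp
  also have "\<dots> = (c ^ ((r - 1) ^ k) * real h powr e) ^ (r - 1)"
  proof -
    have "(real h powr e) ^ (r - 1) = (real h powr e) powr real (r - 1)"
      using h by (intro powr_realpow [symmetric]) simp
    hence "(real h powr e) ^ (r - 1) = real h powr (e * (real r - 1))"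
      by (simp only: powr_powr r(2))
    moreover have "(c ^ ((r - 1) ^ k)) ^ (r - 1) = c ^ ((r - 1) ^ Suc k)" by (simp add: mult.commute flip: power_mult)
    ultimately show ?thesis by (simp add: power_mult_distrib)
  qed
  also have "\<dots> \<le> cmod (u x0 y0) ^ (r - 1)" using le0 c by (intro power_mono) (auto simp: e_def)
  also note gap
  finally have "c ^ ((r - 1) ^ Suc k) * real h powr (1 / (real r - 2) + \<epsilon> * (real r - 1) ^ Suc k) \<le> cmod (u x y)"
    using h by simp
  thus ?case using p by (intro exI[of _ x] exI[of _ y]) (auto simp: xy T_def)
qed

text \<open>
  Suppose that there were \<open>m + 1\<close> aligned solutions. The excess in the exponent of \<open>h\<close> is chosen such that
  it grows to \<open>(r - 3) / (r - 2)\<close> in \<open>m - 1\<close> steps. Hence the last but one of them has size at least a constant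
  times \<open>h\<close>, and it cannot be followed by another one.
\<close>

lemma card_aligned_solutions_le:
  fixes m :: nat and Y :: real
  assumes h: "h \<ge> 1" and m: "m \<ge> 2"
    and Y: "(real r)\<^sup>2 * real h powr (1 / (real r - 2) + (real r - 3) / ((real r - 2) * (real r - 1) ^ (m - 1))) \<le> Y"
  shows "finite (aligned_solutions h Y) \<and> card (aligned_solutions h Y) \<le> m"
proof (rule finite_if_finite_subsets_card_bdd)
  fix G assume G: "G \<subseteq> aligned_solutions h Y" "finite G"
  define \<epsilon> where "\<epsilon> = (real r - 3) / ((real r - 2) * (real r - 1) ^ (m - 1))"
  \<comment> \<open>\<open>norm_u_ge\<close> turns the lower bound for \<open>y\<close> into \<open>c h ^ (i\<^sub>2) \<le> |u|\<close>. As \<open>m \<ge> 2\<close>, at least the fourth power of \<open>c\<close> is available at the end.\<close>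
  define c where "c = sqrt (2/5 * cmod j) * (real r)\<^sup>2"
  have c2: "c\<^sup>2 = 2/5 * cmod j * real r ^ 4" by (simp add: c_def power_mult_distrib flip: power_mult)
  have r4: "real r ^ 4 \<ge> 6 ^ 4" using degree by (intro power_mono) auto
  have c1: "c \<ge> 1"
  proof -
    have "2/5 * (2/3) * 6 ^ 4 \<le> 2/5 * cmod j * real r ^ 4" using r4 norm_j_ge by (intro mult_mono) auto
    hence "1\<^sup>2 \<le> c\<^sup>2" unfolding c2 by simp
    thus ?thesis by (rule power2_le_imp_le) (simp add: c_def)
  qed
  have c4: "c ^ 4 = 4/25 * (cmod j)\<^sup>2 * real r ^ 8"
  proof -
    have "c ^ 4 = (c\<^sup>2)\<^sup>2" by (simp flip: power_mult)
    thus ?thesis unfolding c2 by (simp add: power_mult_distrib power_divide flip: power_mult)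
  qed
  have c4_large: "2 \<le> c ^ 4" "4 * real r ^ 3 * cmod s \<le> c ^ 4"
  proof -
    define M where "M = max 1 (cmod j)"
    have jM: "2/3 * M \<le> cmod j" using norm_j_ge by (auto simp: M_def)
    have M1: "M \<ge> 1" by (simp add: M_def)
    have "4 * M\<^sup>2 * real r ^ 4 = 4/25 * (2/3 * M)\<^sup>2 * (225/4) * real r ^ 4" by (simp add: power2_eq_square)
    also have "\<dots> \<le> 4/25 * (cmod j)\<^sup>2 * real r ^ 4 * real r ^ 4"
      using jM M1 r4 by (intro mult_mono power_mono) auto
    also have "\<dots> = c ^ 4" unfolding c4 by (simp flip: power_add)
    finally have main: "4 * M\<^sup>2 * real r ^ 4 \<le> c ^ 4" .
    have "4 * real r ^ 3 * cmod s \<le> 4 * real r ^ 3 * (real r * M\<^sup>2)"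
      unfolding M_def by (intro mult_left_mono norm_s_le) auto
    also have "\<dots> = 4 * M\<^sup>2 * real r ^ 4" by (simp add: eval_nat_numeral)
    finally show "4 * real r ^ 3 * cmod s \<le> c ^ 4" using main by linarith
    have "1 * 1 \<le> M\<^sup>2 * real r ^ 4" using M1 r4 by (intro mult_mono) auto
    thus "2 \<le> c ^ 4" using main by linarith
  qed
  have start: "c * real h powr (1 / (real r - 2) + \<epsilon>) \<le> cmod (u x y)" if "(x, y) \<in> aligned_solutions h Y" for x y
  proof -
    have xy: "coprime x y" "Y \<le> of_int y" using that by (auto simp: aligned_solutions_def)
    have "(c * real h powr (1 / (real r - 2) + \<epsilon>))\<^sup>2 =
        2/5 * cmod j * ((real r)\<^sup>2 * real h powr (1 / (real r - 2) + \<epsilon>))\<^sup>2"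
      by (simp add: power_mult_distrib c2 flip: power_mult)
    also have "\<dots> \<le> 2/5 * cmod j * (of_int y)\<^sup>2"
      using xy(2) Y unfolding \<epsilon>_def by (intro mult_left_mono power_mono) auto
    also have "\<dots> \<le> (cmod (u x y))\<^sup>2" by (rule norm_u_ge[OF xy(1)])
    finally show ?thesis by (rule power2_le_imp_le) simp
  qed
  show "card G \<le> m"
  proof (rule ccontr)
    assume "\<not> card G \<le> m"
    then obtain X where X: "X \<subseteq> G" "card X = Suc m" "finite X"
      using obtain_subset_with_card_n[of "Suc m" G] G(2) by (metis Suc_leI finite_subset not_le_imp_less)
    hence XA: "X \<subseteq> aligned_solutions h Y" using G by auto
    from aligned_growth[OF h c1 start X(3) XA X(2)] obtain x1 y1 where 1: "(x1, y1) \<in> X"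
      "\<And>x y. (x, y) \<in> X \<Longrightarrow> cmod (u x y) \<le> cmod (u x1 y1)" by blast
    have m1: "Suc (m - 1) = m" using m by simp
    have "card (X - {(x1, y1)}) = Suc (m - 1)" "finite (X - {(x1, y1)})" "X - {(x1, y1)} \<subseteq> aligned_solutions h Y"
      using X XA 1(1) m1 by auto
    from aligned_growth[OF h c1 start this(2,3,1)] obtain x0 y0 where 0: "(x0, y0) \<in> X - {(x1, y1)}"
      "c ^ ((r - 1) ^ (m - 1)) * real h powr (1 / (real r - 2) + \<epsilon> * (real r - 1) ^ (m - 1)) \<le> cmod (u x0 y0)"
      by blast
    have exponent: "1 / (real r - 2) + \<epsilon> * (real r - 1) ^ (m - 1) = 1"
    proof -
      have "real r - 2 \<noteq> 0" "(real r - 1) ^ (m - 1) \<noteq> 0" using degree by auto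
      hence "\<epsilon> * (real r - 1) ^ (m - 1) = (real r - 3) / (real r - 2)" by (simp add: \<epsilon>_def)
      thus ?thesis using degree by (simp add: field_simps)
    qed
    have "4 \<le> (r - 1) ^ 1" using degree by simp
    also have "\<dots> \<le> (r - 1) ^ (m - 1)" using degree m by (intro power_increasing) auto
    finally have "c ^ 4 \<le> c ^ ((r - 1) ^ (m - 1))" using c1 by (intro power_increasing) auto
    hence "c ^ 4 * real h \<le> c ^ ((r - 1) ^ (m - 1)) * real h" by (intro mult_right_mono) auto
    also have "\<dots> \<le> cmod (u x0 y0)" using 0(2) h unfolding exponent by simp
    finally have T0: "c ^ 4 * real h \<le> cmod (u x0 y0)" .
    have large: "2 * real h \<le> cmod (u x0 y0)" "4 * real r ^ 3 * cmod s * real h \<le> cmod (u x0 y0)"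
      using T0 mult_right_mono[OF c4_large(1), of "real h"] mult_right_mono[OF c4_large(2), of "real h"] by auto
    have mem: "(x0, y0) \<in> aligned_solutions h Y" "(x1, y1) \<in> aligned_solutions h Y" using 0 1 XA by auto
    from mem(1) obtain \<phi>0 where s0: "coprime x0 y0" "y0 > 0" "form_eval r F x0 y0 \<noteq> 0"
      "\<bar>form_eval r F x0 y0\<bar> \<le> int h" "\<bar>\<phi>0\<bar> \<le> pi / real r" "v x0 y0 = u x0 y0 * cis \<phi>0"
      by (auto simp: aligned_solutions_def)
    from mem(2) obtain \<phi>1 where s1: "coprime x1 y1" "y1 > 0"
      "\<bar>form_eval r F x1 y1\<bar> \<le> int h" "\<bar>\<phi>1\<bar> \<le> pi / real r" "v x1 y1 = u x1 y1 * cis \<phi>1"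
      by (auto simp: aligned_solutions_def)
    have ind: "x0 * y1 \<noteq> x1 * y0" using s0 s1 0 by (intro primitive_pairs_independent) auto
    have le: "cmod (u x0 y0) \<le> cmod (u x1 y1)" using 0 1 by auto
    show False
      by (rule no_two_large_solutions[OF s0(1) s1(1) ind s0(3) s0(4) s1(3) h s0(6) s1(5) s0(5) s1(4) le large])
  qed
qed

text \<open>
  Multiplying \<open>v\<close> by an \<open>r\<close>-th root of unity does not change the form, so that every root of unity can take
  the place of \<open>1\<close>.
\<close>

lemma rotate_by_root_of_unity:
  assumes "\<omega> ^ r = 1"
  shows "reduced_diagonal_form r F \<alpha> \<beta> (\<omega> * \<gamma>) (\<omega> * \<delta>) (\<omega> * \<kappa>) A B C"
proof
  have \<omega>: "\<omega> \<noteq> 0" using assms degree by (auto simp: power_0_left)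
  have "(\<omega> * \<gamma> * x + \<omega> * \<delta> * y) ^ r = (\<gamma> * x + \<delta> * y) ^ r" for x y
  proof -
    have "\<omega> * \<gamma> * x + \<omega> * \<delta> * y = \<omega> * (\<gamma> * x + \<delta> * y)" by (simp add: algebra_simps)
    thus ?thesis by (simp only: power_mult_distrib assms mult_1)
  qed
  moreover have "\<alpha> * (\<omega> * \<delta>) - \<beta> * (\<omega> * \<gamma>) = \<omega> * j" by (simp add: j_def algebra_simps)
  ultimately show "diagonalization r F \<alpha> \<beta> (\<omega> * \<gamma>) (\<omega> * \<delta>)"
    using diagonalization \<omega> j_nonzero unfolding diagonalization_def by simp
  show "(\<alpha> * x + \<beta> * y) * (\<omega> * \<gamma> * x + \<omega> * \<delta> * y) =
      \<omega> * \<kappa> * (of_int A * x\<^sup>2 + of_int B * x * y + of_int C * y\<^sup>2)" for x y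
  proof -
    have "(\<alpha> * x + \<beta> * y) * (\<omega> * \<gamma> * x + \<omega> * \<delta> * y) = \<omega> * ((\<alpha> * x + \<beta> * y) * (\<gamma> * x + \<delta> * y))"
      by (simp add: algebra_simps)
    thus ?thesis unfolding quadratic by (simp only: mult.assoc)
  qed
qed (use degree negative reduced content in auto)

lemma exists_close_root_of_unity:
  assumes "coprime x y"
  obtains k \<phi> where "k < r" "\<bar>\<phi>\<bar> \<le> pi / real r" "cis (2 * pi * real k / real r) * v x y = u x y * cis \<phi>"
proof -
  have u0: "u x y \<noteq> 0" using u_times_v[of x y] \<kappa>_nonzero Q_pos_coprime[OF assms] by auto
  define z where "z = v x y / u x y"
  have "cmod z = 1" using norm_v[OF assms] u0 by (simp add: z_def norm_divide)
  then obtain \<theta> where \<theta>: "z = cis \<theta>" by (metis cis_Arg norm_zero sgn_eq zero_neq_one div_by_1 of_real_1)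
  have r0: "real r > 0" using degree by simp
  define q where "q = round (real r * \<theta> / (2 * pi))"
  define \<phi> where "\<phi> = \<theta> - 2 * pi * of_int q / real r"
  define k where "k = nat ((- q) mod int r)"
  have k: "int k = (- q) mod int r" "k < r" using degree by (auto simp: k_def nat_less_iff)
  have "\<phi> = - (2 * pi / real r) * (of_int q - real r * \<theta> / (2 * pi))"
    using r0 by (simp add: \<phi>_def field_simps)
  hence "\<bar>\<phi>\<bar> = (2 * pi / real r) * \<bar>of_int q - real r * \<theta> / (2 * pi)\<bar>"
    using r0 by (simp only: abs_mult) simp
  also have "\<dots> \<le> (2 * pi / real r) * (1/2)"
    unfolding q_def by (intro mult_left_mono of_int_round_abs_le) simp
  finally have \<phi>: "\<bar>\<phi>\<bar> \<le> pi / real r" by simp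
  define t where "t = (- q) div int r"
  have "int k = - q - int r * t" unfolding k(1) t_def by (simp add: minus_mult_div_eq_mod)
  hence "real k = - of_int q - real r * of_int t" by (metis of_int_diff of_int_minus of_int_mult of_int_of_nat_eq)
  hence "2 * pi * real k / real r + \<theta> = 2 * pi * (- of_int q - real r * of_int t) / real r + \<theta>"
    by (simp only:)
  also have "\<dots> = \<phi> + 2 * pi * of_int (- t)"
    using r0 by (simp add: \<phi>_def field_simps)
  finally have "2 * pi * real k / real r + \<theta> = \<phi> + 2 * pi * of_int (- t)" .
  hence "cis (2 * pi * real k / real r) * z = cis \<phi> * cis (2 * pi * of_int (- t))"
    unfolding \<theta> cis_mult by (simp only:)
  also have "cis (2 * pi * of_int (- t)) = 1" by (rule cis_multiple_2pi) simp
  finally have "cis (2 * pi * real k / real r) * v x y = u x y * cis \<phi>" using u0 by (simp add: z_def field_simps)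
  thus thesis using k(2) \<phi> by (intro that)
qed

lemma card_primitive_solutions_le:
  fixes m :: nat and Y :: real
  assumes h: "h \<ge> 1" and m: "m \<ge> 2"
    and Y: "(real r)\<^sup>2 * real h powr (1 / (real r - 2) + (real r - 3) / ((real r - 2) * (real r - 1) ^ (m - 1))) \<le> Y"
  shows "finite (primitive_solutions r F h Y) \<and> card (primitive_solutions r F h Y) \<le> m * r"
proof -
  define \<omega> where "\<omega> k = cis (2 * pi * real k / real r)" for k :: nat
  define S where "S k = reduced_diagonal_form.aligned_solutions r F \<alpha> \<beta> (\<omega> k * \<gamma>) (\<omega> k * \<delta>) h Y" for k
  have "\<omega> k ^ r = 1" for k
  proof -
    have "\<omega> k ^ r = cis (2 * pi * real k)" using degree by (simp add: \<omega>_def Complex.DeMoivre)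
    also have "\<dots> = 1" by (rule cis_multiple_2pi) simp
    finally show ?thesis .
  qed
  note rot = rotate_by_root_of_unity[OF this]
  have S: "finite (S k)" "card (S k) \<le> m" for k
    using reduced_diagonal_form.card_aligned_solutions_le[OF rot h m Y] by (simp_all add: S_def)
  have sub: "primitive_solutions r F h Y \<subseteq> (\<Union>k<r. S k)"
  proof clarify
    fix x y assume "(x, y) \<in> primitive_solutions r F h Y"
    hence xy: "coprime x y" "form_eval r F x y \<noteq> 0" "\<bar>form_eval r F x y\<bar> \<le> int h" "Y \<le> of_int y"
      by (auto simp: primitive_solutions_def coprime_iff_gcd_eq_1)
    have "0 < (real r)\<^sup>2 * real h powr (1 / (real r - 2) + (real r - 3) / ((real r - 2) * (real r - 1) ^ (m - 1)))"
      using degree h by simp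
    hence y: "y > 0" using Y xy(4) by linarith
    obtain k \<phi> where k: "k < r" "\<bar>\<phi>\<bar> \<le> pi / real r" "\<omega> k * v x y = u x y * cis \<phi>"
      unfolding \<omega>_def using exists_close_root_of_unity[OF xy(1)] by blast
    have "\<omega> k * \<gamma> * of_int x + \<omega> k * \<delta> * of_int y = u x y * cis \<phi>"
      using k(3) by (simp add: v_def algebra_simps)
    hence "(x, y) \<in> S k"
      unfolding S_def reduced_diagonal_form.aligned_solutions_def[OF rot]
        reduced_diagonal_form.u_def[OF rot] reduced_diagonal_form.v_def[OF rot]
      using xy y k(2) by (auto simp: u_def)
    thus "(x, y) \<in> (\<Union>k<r. S k)" using k(1) by auto
  qed
  have fin: "finite (\<Union>k<r. S k)" using S by auto
  have "card (primitive_solutions r F h Y) \<le> card (\<Union>k<r. S k)" using sub fin by (rule card_mono[rotated])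
  also have "\<dots> \<le> (\<Sum>k<r. card (S k))" by (rule card_UN_le) simp
  also have "\<dots> \<le> (\<Sum>k<r. m)" by (intro sum_mono S)
  finally show ?thesis using finite_subset[OF sub fin] by (simp add: mult.commute)
qed

end

lemma num_solutions_le_card:
  assumes "finite (primitive_solutions r F h Y)"
  shows "finite (solution_classes r F h Y)" "num_solutions r F h Y \<le> card (primitive_solutions r F h Y)"
  using assms unfolding num_solutions_def solution_classes_def by (auto intro: card_image_le)

theorem theorem1p7:
  fixes r h m :: nat
    and F :: "nat \<Rightarrow> int"
    and \<alpha> \<beta> \<gamma> \<delta> j :: complex
    and A B C D :: int
    and i1 i2 i3 Y_L :: real
  assumes "r \<ge> 6"
    and "diagonalization r F \<alpha> \<beta> \<gamma> \<delta>"
    and "j = \<alpha> * \<delta> - \<beta> * \<gamma>"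
    and "associated_quadratic \<alpha> \<beta> \<gamma> \<delta> A B C"
    and "D = B\<^sup>2 - 4 * A * C"
    and "D < 0"
    and "reduced_quadratic A B C"
    and "h > 0"
    and "m \<ge> 2"
    and "i1 = 2 + 2 / real r"
    and "i2 = 1 / (real r - 2) + (real r - 3) / ((real r - 2) * (real r - 1) ^ (m - 1))"
    and "i3 = (if cmod j \<ge> 1 then 0 else real r / (2 * (real r - 2)))"
    and "Y_L = real r powr i1 * real h powr i2 / cmod j powr i3"
  shows "finite (solution_classes r F h Y_L) \<and> num_solutions r F h Y_L \<le> m * r"
proof -
  obtain \<kappa> where \<kappa>: "\<And>x y. (\<alpha> * x + \<beta> * y) * (\<gamma> * x + \<delta> * y) =
        \<kappa> * (of_int A * x\<^sup>2 + of_int B * x * y + of_int C * y\<^sup>2)"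
    using assms(4) unfolding associated_quadratic_def by blast
  define g where "g = gcd A (gcd B C)"
  define A' B' C' where "A' = A div g" and "B' = B div g" and "C' = C div g"
  have "A \<noteq> 0 \<or> B \<noteq> 0 \<or> C \<noteq> 0" using assms(5,6) by auto
  hence g: "g > 0" by (auto simp: g_def gcd_pos_int)
  have "g dvd A" "g dvd B" "g dvd C" by (auto simp: g_def intro: dvd_trans[OF gcd_dvd2])
  hence ABC: "A = g * A'" "B = g * B'" "C = g * C'" by (simp_all add: A'_def B'_def C'_def)
  have content: "gcd A' (gcd B' C') = 1"
  proof -
    have "g * gcd A' (gcd B' C') = gcd A (gcd B C)"
      unfolding ABC using g by (simp add: gcd_mult_left abs_mult)
    hence "g * gcd A' (gcd B' C') = g * 1" by (simp only: g_def mult_1_right)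
    thus ?thesis using g by (simp only: mult_cancel_left) auto
  qed
  interpret reduced_diagonal_form r F \<alpha> \<beta> \<gamma> \<delta> "\<kappa> * of_int g" A' B' C'
  proof
    show "(\<alpha> * x + \<beta> * y) * (\<gamma> * x + \<delta> * y) =
        \<kappa> * of_int g * (of_int A' * x\<^sup>2 + of_int B' * x * y + of_int C' * y\<^sup>2)" for x y
      unfolding \<kappa> ABC by (simp add: algebra_simps)
    have "D = g\<^sup>2 * (B'\<^sup>2 - 4 * A' * C')" unfolding assms(5) ABC by (simp add: power2_eq_square algebra_simps)
    thus "B'\<^sup>2 - 4 * A' * C' < 0" using assms(6) g by (simp add: mult_less_0_iff)
    show "reduced_quadratic A' B' C'"
      using assms(7) g unfolding reduced_quadratic_def ABC by (simp add: abs_mult)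
  qed (use assms content in auto)
  have Y: "(real r)\<^sup>2 * real h powr i2 \<le> Y_L"
  proof -
    have j0: "cmod j > 0" using assms(2,3) by (auto simp: diagonalization_def)
    have "cmod j powr i3 \<le> 1"
    proof (cases "cmod j \<ge> 1")
      case False
      hence "cmod j powr i3 \<le> 1 powr i3" using j0 assms(1,12) by (intro powr_mono2) auto
      thus ?thesis by simp
    qed (use assms(12) j0 in simp)
    moreover have "cmod j powr i3 > 0" using j0 by simp
    ultimately have 1: "1 \<le> 1 / cmod j powr i3" by simp
    have "(real r)\<^sup>2 = real r powr 2" using assms(1) by (simp flip: powr_numeral)
    also have "\<dots> \<le> real r powr i1" using assms(1,10) by (intro powr_mono) auto
    finally have "(real r)\<^sup>2 * real h powr i2 \<le> real r powr i1 * real h powr i2" by (intro mult_right_mono) auto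
    also have "\<dots> \<le> real r powr i1 * real h powr i2 * (1 / cmod j powr i3)"
      using mult_left_mono[OF 1, of "real r powr i1 * real h powr i2"] by simp
    finally show ?thesis unfolding assms(13) by simp
  qed
  have "h \<ge> 1" using assms(8) by simp
  from card_primitive_solutions_le[OF this assms(9) Y[unfolded assms(11)]]
  have "finite (primitive_solutions r F h Y_L)" "card (primitive_solutions r F h Y_L) \<le> m * r" by simp_all
  thus ?thesis using num_solutions_le_card order_trans by blast
qed

end
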